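(* Let $G$ be a directed graph with $n$ vertices and $m$ edges, let $s,t\in V(G)$, let $w\colon E(G)\to\mathbb{R}_{+}$ be a positive edge-weight function, and let $k\in\mathbb{N}$. Whether there exists a forcing set $S\subseteq E(G)$ for shortest $s$-$t$ paths in $(G,w)$ with $|S|\le k$ can be decided in time $O(nm)$. Moreover, when additionally given a shortest $s$-$t$ path $P$ in $(G,w)$, a minimum-cardinality forcing set for $P$ can be computed in time $O(nm)$.
   Context: A set $S\subseteq E(G)$ is a forcing set for a shortest $s$-$t$ path $P$ if $S\subseteq E(P)$ and no other shortest $s$-$t$ path $P'\neq P$ in $(G,w)$ satisfies $S\subseteq E(P')$. A set $S$ is a forcing set for shortest $s$-$t$ paths if it is a forcing set for some shortest $s$-$t$ path, i.e., there is exactly one shortest $s$-$t$ path containing all edges of $S$. *)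

theory Defs
  imports
    "Graph_Theory.Weighted_Graph"
    "HOL-Library.More_List"
begin

section \<open>Forcing sets\<close>

text \<open>Paths are lists of arcs, so parallel arcs give different paths and the edge set of a
  path \<^term>\<open>p\<close> is \<^term>\<open>set p\<close>.\<close>

context wf_digraph
begin

definition shortest_path :: "'b weight_fun \<Rightarrow> 'a \<Rightarrow> 'a \<Rightarrow> 'b awalk \<Rightarrow> bool" where
  "shortest_path w s t p \<longleftrightarrow> is_arg_min (awalk_cost w) (\<lambda>q. apath s q t) p"

definition forcing_set_for :: "'b weight_fun \<Rightarrow> 'a \<Rightarrow> 'a \<Rightarrow> 'b awalk \<Rightarrow> 'b set \<Rightarrow> bool" where
  "forcing_set_for w s t p S \<longleftrightarrow>
     S \<subseteq> arcs G \<and> shortest_path w s t p \<and> S \<subseteq> set p \<and>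
     (\<forall>p'. shortest_path w s t p' \<and> p' \<noteq> p \<longrightarrow> \<not> S \<subseteq> set p')"

definition forcing_set :: "'b weight_fun \<Rightarrow> 'a \<Rightarrow> 'a \<Rightarrow> 'b set \<Rightarrow> bool" where
  "forcing_set w s t S \<longleftrightarrow> (\<exists>p. forcing_set_for w s t p S)"

definition min_forcing_set_for :: "'b weight_fun \<Rightarrow> 'a \<Rightarrow> 'a \<Rightarrow> 'b awalk \<Rightarrow> 'b set \<Rightarrow> bool" where
  "min_forcing_set_for w s t p S \<longleftrightarrow> is_arg_min card (forcing_set_for w s t p) S"

end

section \<open>The machine model\<close>

text \<open>
  Running times refer to a deterministic real-number random access machine with structured
  control flow. A program is a finite piece of syntax and hence uses finitely many
  arrays of natural numbers and finitely many arrays of reals; a scalar variable is cell 0 of an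
  array. Each syntax node that is evaluated costs one time unit.

  The operations are deliberately weak. On natural numbers there are only increment, decrement,
  comparison and indirect addressing, so in time \<open>T\<close> no number can exceed the largest input
  number (or program constant) by more than \<open>T\<close>; thus unit cost is not abused by operating on
  huge integers. On reals there are only addition and comparison, and reals cannot be
  converted to natural numbers.
\<close>

record mem =
  nats :: "nat \<Rightarrow> nat \<Rightarrow> nat"
  reals :: "nat \<Rightarrow> nat \<Rightarrow> real"

datatype nexp = NConst nat | NGet nat nexp | Inc nexp | Dec nexp

datatype rexp = RZero | RGet nat nexp | RAdd rexp rexp

datatype bexp = NLess nexp nexp | RLess rexp rexp | BNot bexp | BAnd bexp bexp

datatype com =
    Skip
  | NSet nat nexp nexp
  | RSet nat nexp rexp
  | Seq com com
  | Cond bexp com com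
  | While bexp com

primrec nval :: "mem \<Rightarrow> nexp \<Rightarrow> nat" where
  "nval \<sigma> (NConst c) = c"
| "nval \<sigma> (NGet a i) = nats \<sigma> a (nval \<sigma> i)"
| "nval \<sigma> (Inc e) = nval \<sigma> e + 1"
| "nval \<sigma> (Dec e) = nval \<sigma> e - 1"

primrec rval :: "mem \<Rightarrow> rexp \<Rightarrow> real" where
  "rval \<sigma> RZero = 0"
| "rval \<sigma> (RGet a i) = reals \<sigma> a (nval \<sigma> i)"
| "rval \<sigma> (RAdd e f) = rval \<sigma> e + rval \<sigma> f"

primrec bval :: "mem \<Rightarrow> bexp \<Rightarrow> bool" where
  "bval \<sigma> (NLess e f) \<longleftrightarrow> nval \<sigma> e < nval \<sigma> f"
| "bval \<sigma> (RLess e f) \<longleftrightarrow> rval \<sigma> e < rval \<sigma> f"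
| "bval \<sigma> (BNot b) \<longleftrightarrow> \<not> bval \<sigma> b"
| "bval \<sigma> (BAnd b c) \<longleftrightarrow> bval \<sigma> b \<and> bval \<sigma> c"

primrec ncost :: "nexp \<Rightarrow> nat" where
  "ncost (NConst c) = 1"
| "ncost (NGet a i) = 1 + ncost i"
| "ncost (Inc e) = 1 + ncost e"
| "ncost (Dec e) = 1 + ncost e"

primrec rcost :: "rexp \<Rightarrow> nat" where
  "rcost RZero = 1"
| "rcost (RGet a i) = 1 + ncost i"
| "rcost (RAdd e f) = 1 + rcost e + rcost f"

primrec bcost :: "bexp \<Rightarrow> nat" where
  "bcost (NLess e f) = 1 + ncost e + ncost f"
| "bcost (RLess e f) = 1 + rcost e + rcost f"
| "bcost (BNot b) = 1 + bcost b"
| "bcost (BAnd b c) = 1 + bcost b + bcost c"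

definition nset :: "nat \<Rightarrow> nat \<Rightarrow> nat \<Rightarrow> mem \<Rightarrow> mem" where
  "nset a i x \<sigma> = \<sigma>\<lparr>nats := (nats \<sigma>)(a := (nats \<sigma> a)(i := x))\<rparr>"

definition rset :: "nat \<Rightarrow> nat \<Rightarrow> real \<Rightarrow> mem \<Rightarrow> mem" where
  "rset a i x \<sigma> = \<sigma>\<lparr>reals := (reals \<sigma>)(a := (reals \<sigma> a)(i := x))\<rparr>"

text \<open>\<^term>\<open>exec c \<sigma> \<tau> \<sigma>'\<close>: started in memory \<^term>\<open>\<sigma>\<close>, the program \<^term>\<open>c\<close> halts after exactly
  \<^term>\<open>\<tau>\<close> time units in memory \<^term>\<open>\<sigma>'\<close>.\<close>

inductive exec :: "com \<Rightarrow> mem \<Rightarrow> nat \<Rightarrow> mem \<Rightarrow> bool" where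
  Skip: "exec Skip \<sigma> 1 \<sigma>"
| NSet: "exec (NSet a i e) \<sigma> (1 + ncost i + ncost e) (nset a (nval \<sigma> i) (nval \<sigma> e) \<sigma>)"
| RSet: "exec (RSet a i e) \<sigma> (1 + ncost i + rcost e) (rset a (nval \<sigma> i) (rval \<sigma> e) \<sigma>)"
| Seq: "\<lbrakk> exec c \<sigma> \<tau> \<sigma>'; exec d \<sigma>' \<tau>' \<sigma>'' \<rbrakk> \<Longrightarrow> exec (Seq c d) \<sigma> (1 + \<tau> + \<tau>') \<sigma>''"
| CondTrue: "\<lbrakk> bval \<sigma> b; exec c \<sigma> \<tau> \<sigma>' \<rbrakk> \<Longrightarrow> exec (Cond b c d) \<sigma> (1 + bcost b + \<tau>) \<sigma>'"
| CondFalse: "\<lbrakk> \<not> bval \<sigma> b; exec d \<sigma> \<tau> \<sigma>' \<rbrakk> \<Longrightarrow> exec (Cond b c d) \<sigma> (1 + bcost b + \<tau>) \<sigma>'"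
| WhileFalse: "\<not> bval \<sigma> b \<Longrightarrow> exec (While b c) \<sigma> (1 + bcost b) \<sigma>"
| WhileTrue: "\<lbrakk> bval \<sigma> b; exec c \<sigma> \<tau> \<sigma>'; exec (While b c) \<sigma>' \<tau>' \<sigma>'' \<rbrakk>
    \<Longrightarrow> exec (While b c) \<sigma> (1 + bcost b + \<tau> + \<tau>') \<sigma>''"

inductive_cases SkipE: "exec Skip \<sigma> \<tau> \<sigma>'"
  and NSetE: "exec (NSet a i e) \<sigma> \<tau> \<sigma>'"
  and RSetE: "exec (RSet a i e) \<sigma> \<tau> \<sigma>'"
  and SeqE: "exec (Seq c d) \<sigma> \<tau> \<sigma>'"
  and CondE: "exec (Cond b c d) \<sigma> \<tau> \<sigma>'"
  and WhileE: "exec (While b c) \<sigma> \<tau> \<sigma>'"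

lemma exec_deterministic:
  "exec c \<sigma> \<tau> \<sigma>' \<Longrightarrow> exec c \<sigma> \<rho> \<sigma>2 \<Longrightarrow> \<rho> = \<tau> \<and> \<sigma>2 = \<sigma>'"
proof (induction arbitrary: \<rho> \<sigma>2 rule: exec.induct)
  case Skip then show ?case by (rule SkipE) simp
next
  case NSet then show ?case by (rule NSetE) simp
next
  case RSet then show ?case by (rule RSetE) simp
next
  case Seq
  from Seq.prems show ?case by (rule SeqE) (auto dest!: Seq.IH)
next
  case CondTrue
  from CondTrue.prems show ?case by (rule CondE) (use CondTrue.hyps(1) in \<open>auto dest!: CondTrue.IH\<close>)
next
  case CondFalse
  from CondFalse.prems show ?case by (rule CondE) (use CondFalse.hyps(1) in \<open>auto dest!: CondFalse.IH\<close>)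
next
  case WhileFalse
  from WhileFalse.prems show ?case by (rule WhileE) (use WhileFalse.hyps in simp_all)
next
  case WhileTrue
  from WhileTrue.prems show ?case by (rule WhileE) (use WhileTrue.hyps(1) in \<open>auto dest!: WhileTrue.IH\<close>)
qed

section \<open>Input and output conventions\<close>

text \<open>As is usual for inputs of algorithms, the vertices are numbered from 0 to \<open>n - 1\<close> and the
  arcs from 0 to \<open>m - 1\<close>. Loops and parallel arcs are permitted.\<close>

definition numbered_digraph :: "(nat, nat) pre_digraph \<Rightarrow> bool" where
  "numbered_digraph G \<longleftrightarrow>
     fin_digraph G \<and> verts G = {..<card (verts G)} \<and> arcs G = {..<card (arcs G)}"

text \<open>Number array 0 contains \<open>n\<close>, \<open>m\<close>, \<open>s\<close>, \<open>t\<close> and one more parameter \<open>x\<close>, arrays 1 and 2 contain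
  the tails and the heads of the arcs, array 3 contains a list \<open>p\<close> of arcs, and real array 0
  contains the arc weights. All other cells are 0.\<close>

definition input_mem ::
  "(nat, nat) pre_digraph \<Rightarrow> (nat \<Rightarrow> real) \<Rightarrow> nat \<Rightarrow> nat \<Rightarrow> nat \<Rightarrow> nat list \<Rightarrow> mem" where
  "input_mem G w s t x p =
     (let n = card (verts G); m = card (arcs G) in
      \<lparr> nats = (\<lambda>_ _. 0)
          (0 := nth_default 0 [n, m, s, t, x],
           1 := nth_default 0 (map (tail G) [0..<m]),
           2 := nth_default 0 (map (head G) [0..<m]),
           3 := nth_default 0 p),
        reals = (\<lambda>_ _. 0)(0 := nth_default 0 (map w [0..<m])) \<rparr>)"

definition decision_input ::
  "(nat, nat) pre_digraph \<Rightarrow> (nat \<Rightarrow> real) \<Rightarrow> nat \<Rightarrow> nat \<Rightarrow> nat \<Rightarrow> mem" where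
  "decision_input G w s t k = input_mem G w s t k []"

definition path_input ::
  "(nat, nat) pre_digraph \<Rightarrow> (nat \<Rightarrow> real) \<Rightarrow> nat \<Rightarrow> nat \<Rightarrow> nat list \<Rightarrow> mem" where
  "path_input G w s t p = input_mem G w s t (length p) p"

definition bool_output :: "mem \<Rightarrow> nat" where
  "bool_output \<sigma> = nats \<sigma> 4 0"

definition list_output :: "mem \<Rightarrow> nat list" where
  "list_output \<sigma> = map (nats \<sigma> 5) [0..<nats \<sigma> 4 0]"

end

theory Submission
  imports Defs
begin

text \<open>
  The arcs that are tight for the distances \<open>d\<close> from \<open>s\<close> form an acyclic graph, and its walks from
  \<open>s\<close> to \<open>t\<close> are exactly the shortest paths. A set \<open>S\<close> of arcs forces such a walk iff the tight
  walks between consecutive arcs of \<open>S\<close> (and from \<open>s\<close> to the first and from the last to \<open>t\<close>) are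
  unique. Whether there is a unique tight walk from \<open>u\<close> to \<open>v\<close> is found for a fixed \<open>u\<close> and all \<open>v\<close>
  in time \<open>O(m)\<close> by counting walks, with counts capped at 2, along the tight arcs in topological
  order. Hence the least size of a forcing set is a shortest-path value with one relaxation
  pass over the tight arcs per vertex \<open>u\<close>, taken in order of distance. If the path is given, greedily
  extending the current segment as long as it is the unique walk between its ends, and selecting
  the arc that destroys uniqueness, is optimal: every forcing set must meet each of the disjoint
  segments closed by the selected arcs. The distances come from Dijkstra's algorithm with a linear
  scan per round, which lists the vertices by distance and the tight arcs by the distance of their
  heads, so no sorting is necessary.
\<close>

section \<open>Unique walks and forcing sets in graded graphs\<close>

definition capped :: "'c set \<Rightarrow> nat" where
  "capped X = (if X = {} then 0 else if \<exists>x. X = {x} then 1 else 2)"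

lemma capped_simps [simp]: "capped {} = 0" "capped {x} = 1"
  by (auto simp: capped_def)

lemma capped_eq_1: "capped X = Suc 0 \<longleftrightarrow> (\<exists>x. X = {x})"
  by (auto simp: capped_def)

lemma capped_eq_0: "capped X = 0 \<longleftrightarrow> X = {}"
  by (auto simp: capped_def)

text \<open>Capped counts add over a disjoint union, and injectivity gives the image the count of
  \<open>Y\<close>. The sum is written as nested tests because \<open>sweep\<close> updates a count
  in just this way, by comparisons and constants.\<close>

lemma capped_Un_image:
  assumes "inj f" "X \<inter> f ` Y = {}"
  shows "capped (X \<union> f ` Y) =
    (if capped Y = 0 then capped X else if capped Y < 2 \<and> capped X < 1 then 1 else 2)"
proof -
  consider "Y = {}" | y where "Y = {y}" | "Y \<noteq> {}" "\<nexists>y. Y = {y}" by blast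
  then show ?thesis
  proof cases
    case 2
    have "capped (insert (f y) X) = 2" if "X \<noteq> {}"
      using that assms(2) 2 by (auto simp: capped_def)
    then show ?thesis using 2 by (auto simp: capped_eq_0)
  next
    case 3
    then obtain y z where yz: "y \<in> Y" "z \<in> Y" "y \<noteq> z" by blast
    have "f y \<noteq> f z" using yz assms(1) by (auto dest: injD)
    then have "X \<union> f ` Y \<noteq> {x}" for x using yz by (metis UnI2 imageI singletonD)
    moreover have "X \<union> f ` Y \<noteq> {}" using yz by auto
    ultimately have "capped (X \<union> f ` Y) = 2" by (simp add: capped_def)
    then show ?thesis using 3 by (auto simp: capped_def)
  qed simp
qed

section \<open>Walks with arcs in a given set\<close>

context pre_digraph
begin

definition walks :: "'b set \<Rightarrow> 'a \<Rightarrow> 'a \<Rightarrow> 'b list set" where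
  "walks E u v = {p. cas u p v \<and> set p \<subseteq> E}"

lemma cas_append: "cas u (p @ q) v \<longleftrightarrow> (\<exists>x. cas u p x \<and> cas x q v)"
  by (induction p arbitrary: u) auto

lemma walks_Nil: "[] \<in> walks E u v \<longleftrightarrow> u = v"
  by (simp add: walks_def)

lemma walks_Cons: "e # p \<in> walks E u v \<longleftrightarrow> e \<in> E \<and> tail G e = u \<and> p \<in> walks E (head G e) v"
  by (auto simp: walks_def)

lemma walks_append: "p @ q \<in> walks E u v \<longleftrightarrow> (\<exists>x. p \<in> walks E u x \<and> q \<in> walks E x v)"
  by (auto simp: walks_def cas_append simp del: cas_append_iff)

lemma walks_mid:
  "p @ e # q \<in> walks E u v \<longleftrightarrow> e \<in> E \<and> p \<in> walks E u (tail G e) \<and> q \<in> walks E (head G e) v"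
  by (auto simp: walks_append walks_Cons)

lemma walks_snoc: "p @ [e] \<in> walks E u v \<longleftrightarrow> e \<in> E \<and> p \<in> walks E u (tail G e) \<and> head G e = v"
  by (auto simp: walks_mid walks_Nil)

lemma walks_empty: "walks {} u v = (if u = v then {[]} else {})"
  by (auto simp: walks_def)

text \<open>No arc leaves the head of \<open>e\<close>, so \<open>e\<close> can occur only as the
  last arc of a walk.\<close>

lemma walks_insert:
  assumes "\<forall>b\<in>insert e E. tail G b \<noteq> head G e" "e \<notin> E"
  shows "walks (insert e E) u v =
    walks E u v \<union> (if v = head G e then (\<lambda>p. p @ [e]) ` walks E u (tail G e) else {})"
    (is "?L = ?R")
proof
  show "?R \<subseteq> ?L" by (auto simp: walks_def cas_append simp del: cas_append_iff split: if_splits)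
next
  have *: "p \<in> walks E u v \<or> v = head G e \<and> (\<exists>q\<in>walks E u (tail G e). p = q @ [e])"
    if "p \<in> walks (insert e E) u v" for p u
    using that
  proof (induction p arbitrary: u)
    case Nil
    then show ?case by (simp add: walks_Nil)
  next
    case (Cons a p)
    then have a: "a \<in> insert e E" "tail G a = u" "p \<in> walks (insert e E) (head G a) v"
      by (auto simp: walks_Cons)
    show ?case
    proof (cases "a = e")
      case True
      have "p = []"
        using a(3) assms(1) True by (cases p) (auto simp: walks_Cons)
      then show ?thesis using a True by (auto simp: walks_Nil intro: bexI[of _ "[]"])
    next
      case False
      with a Cons.IH[of "head G a"] show ?thesis
        by (auto simp: walks_Cons intro!: bexI[of _ "a # _"])
    qed
  qed
  then show "?L \<subseteq> ?R" by (auto split: if_splits)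
qed

end

section \<open>Unique walks along arcs that increase a level function\<close>

locale graded_arcs = pre_digraph G for G :: "('a, 'b) pre_digraph" (structure) +
  fixes E :: "'b set" and d :: "'a \<Rightarrow> real" and s :: 'a
  assumes graded: "e \<in> E \<Longrightarrow> d (tail G e) < d (head G e)"
begin

abbreviation "W \<equiv> walks E"

lemma walks_le: "p \<in> W u v \<Longrightarrow> d u \<le> d v"
proof (induction p arbitrary: u)
  case (Cons a p)
  then have "d u < d (head G a)" "d (head G a) \<le> d v"
    using graded[of a] by (auto simp: walks_Cons)
  then show ?case by simp
qed (simp add: walks_Nil)

lemma walks_through:
  assumes "p \<in> W u v" "e \<in> set p"
  shows "d u \<le> d (tail G e)" "d (head G e) \<le> d v" "e \<in> E"
proof -
  from assms(2) obtain q r where "p = q @ e # r" by (meson split_list)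
  with assms(1) show "d u \<le> d (tail G e)" "d (head G e) \<le> d v" "e \<in> E"
    by (auto simp: walks_mid intro: walks_le)
qed

lemma walks_refl: "W u u = {[]}"
proof -
  have "p = []" if "p \<in> W u u" for p
  proof (cases p)
    case (Cons a q)
    with that have "a \<in> E" "tail G a = u" "d (head G a) \<le> d u"
      by (auto simp: walks_Cons intro: walks_le)
    then show ?thesis using graded[of a] by simp
  qed
  then show ?thesis by (auto simp: walks_Nil)
qed

lemma distinct_walk: "p \<in> W u v \<Longrightarrow> distinct p"
proof (induction p arbitrary: u)
  case (Cons a p)
  then have "a \<in> E" "p \<in> W (head G a) v" by (auto simp: walks_Cons)
  then show ?case using Cons.IH walks_through(1)[of p "head G a" v a] graded[of a] by auto
qed simp

text \<open>\<open>q\<close> is a common prefix of all walks from \<open>s\<close> that contain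
  \<open>S\<close>. The end \<open>z\<close> varies, so that no target is fixed while
  \<open>S\<close> is enlarged arc by arc.\<close>

definition forced :: "'b set \<Rightarrow> 'b list \<Rightarrow> 'a \<Rightarrow> bool" where
  "forced S q u \<longleftrightarrow> q \<in> W s u \<and> S \<subseteq> set q \<and>
    (\<forall>z. \<forall>p\<in>W s z. S \<subseteq> set p \<longrightarrow> (\<exists>r\<in>W u z. p = q @ r))"

lemma forcedD:
  "forced S q u \<Longrightarrow> p \<in> W s z \<Longrightarrow> S \<subseteq> set p \<Longrightarrow> \<exists>r\<in>W u z. p = q @ r"
  by (simp add: forced_def)

lemma forced_start: "forced {} [] s"
  by (auto simp: forced_def walks_Nil)

text \<open>A walk that contains \<open>S\<close> and \<open>a\<close> starts with \<open>q\<close>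
  and meets \<open>a\<close> only afterwards; the part between \<open>q\<close> and \<open>a\<close>
  can only be \<open>r\<close>.\<close>

lemma forced_step:
  assumes "forced S q u" "W u (tail G a) = {r}" "a \<in> E"
  shows "forced (insert a S) (q @ r @ [a]) (head G a)"
proof -
  have r: "r \<in> W u (tail G a)" using assms(2) by auto
  have q: "q \<in> W s u" "S \<subseteq> set q" using assms(1) by (auto simp: forced_def)
  have "\<exists>r'\<in>W (head G a) z. p = (q @ r @ [a]) @ r'"
    if p: "p \<in> W s z" "insert a S \<subseteq> set p" for p z
  proof -
    from forcedD[OF assms(1) p(1)] p(2) obtain x where x: "x \<in> W u z" "p = q @ x" by auto
    \<comment> \<open>Arcs of \<open>q\<close> end at level \<open>d u\<close> or below, whereas
      \<open>a\<close> starts at the end of \<open>r\<close>, at level \<open>d u\<close> or above,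
      and ends strictly higher.\<close>
    have "a \<notin> set q"
      using walks_through(2)[OF q(1), of a] walks_le[OF r] graded[OF assms(3)] by force
    then have "a \<in> set x" using p x by auto
    then obtain x1 x2 where "x = x1 @ a # x2" by (meson split_list)
    then show ?thesis using x assms(2) by (auto simp: walks_mid)
  qed
  then show ?thesis using q r assms(3) unfolding forced_def
    by (auto simp: walks_append walks_Cons walks_Nil)
qed

lemma forced_unique:
  assumes "forced S q u" "W u t = {r}" "p \<in> W s t" "S \<subseteq> set p"
  shows "p = q @ r"
  using forcedD[OF assms(1,3,4)] assms(2) by auto

text \<open>\<^term>\<open>jumps k u\<close>: some \<^term>\<open>k\<close> arcs, the last of which ends in \<^term>\<open>u\<close>, determine the walk
  from \<^term>\<open>s\<close> to \<^term>\<open>u\<close> because the walks between consecutive ones are unique.\<close>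

inductive jumps :: "nat \<Rightarrow> 'a \<Rightarrow> bool" where
  start: "jumps 0 s"
| jump: "jumps k u \<Longrightarrow> W u (tail G a) = {r} \<Longrightarrow> a \<in> E \<Longrightarrow> jumps (Suc k) (head G a)"

lemma jumps_forced: "jumps k u \<Longrightarrow> \<exists>S q. forced S q u \<and> finite S \<and> card S \<le> k"
proof (induction rule: jumps.induct)
  case start
  then show ?case using forced_start by fastforce
next
  case (jump k u a r)
  then obtain S q where S: "forced S q u" "finite S" "card S \<le> k" by blast
  then have "card (insert a S) \<le> Suc k" by (simp add: card_insert_if)
  with S forced_step[OF S(1) jump(2,3)] show ?case by (meson finite_insert)
qed

text \<open>The walk \<open>p\<close> is cut at each of its arcs in \<open>S\<close>. The piece
  before such an arc contains no arc of \<open>S\<close>, so replacing it would preserve all arcs of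
  \<open>S\<close>; uniqueness of \<open>p\<close> therefore makes the piece unique, which permits a
  jump.\<close>

lemma unique_jumps:
  assumes "p \<in> W u t" "jumps k u" "\<And>p'. p' \<in> W u t \<Longrightarrow> S \<inter> set p \<subseteq> set p' \<Longrightarrow> p' = p"
  shows "\<exists>k' u' r. jumps k' u' \<and> W u' t = {r} \<and> k' \<le> k + card (S \<inter> set p)"
  using assms
proof (induction p arbitrary: u k rule: length_induct)
  case (1 p)
  show ?case
  proof (cases "S \<inter> set p = {}")
    case True
    then have "\<And>p'. p' \<in> W u t \<Longrightarrow> p' = p" using "1.prems"(3) by simp
    then have "W u t = {p}" using "1.prems"(1) by blast
    then show ?thesis using "1.prems"(2)
      by (intro exI[of _ k] exI[of _ u] exI[of _ p]) simp
  next
    case False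
    then obtain r a q where p: "p = r @ a # q" "a \<in> S" "\<forall>b\<in>set r. b \<notin> S"
      using split_list_first_prop[of p "\<lambda>b. b \<in> S"] by blast
    have w: "a \<in> E" "r \<in> W u (tail G a)" "q \<in> W (head G a) t"
      using "1.prems"(1) by (auto simp: p walks_mid)
    have "r' = r" if "r' \<in> W u (tail G a)" for r'
    proof -
      have "r' @ a # q = p"
        using that w p by (intro "1.prems"(3)) (auto simp: walks_mid)
      then show ?thesis by (simp add: p)
    qed
    then have "W u (tail G a) = {r}" using w(2) by blast
    then have j: "jumps (Suc k) (head G a)" using "1.prems"(2) w by (intro jumps.jump)
    have "q' = q" if "q' \<in> W (head G a) t" "S \<inter> set q \<subseteq> set q'" for q'
    proof -
      have "r @ a # q' = p"
        using that w p by (intro "1.prems"(3)) (auto simp: walks_mid)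
      then show ?thesis by (simp add: p)
    qed
    moreover have "length q < length p" by (simp add: p(1))
    ultimately obtain k' u' r' where
      "jumps k' u'" "W u' t = {r'}" "k' \<le> Suc k + card (S \<inter> set q)"
      using "1.IH" w(3) j by blast
    moreover have "S \<inter> set p = insert a (S \<inter> set q)" "a \<notin> set q"
      using p distinct_walk[OF "1.prems"(1)] by auto
    ultimately show ?thesis by (intro exI[of _ k'] exI[of _ u'] exI[of _ r']) simp
  qed
qed

text \<open>From left to right, \<open>unique_jumps\<close> starts in \<open>s\<close> with no jump
  made. From right to left, the arcs supplied by \<open>jumps_forced\<close> fix the walk up to
  \<open>u\<close>, and the unique walk from there to \<open>t\<close> completes it.\<close>

lemma ex_unique_iff_jumps:
  "(\<exists>S p. finite S \<and> card S \<le> k \<and> p \<in> W s t \<and> S \<subseteq> set p \<and> (\<forall>p'\<in>W s t. S \<subseteq> set p' \<longrightarrow> p' = p))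
    \<longleftrightarrow> (\<exists>k' u r. k' \<le> k \<and> jumps k' u \<and> W u t = {r})" (is "?L \<longleftrightarrow> ?R")
proof
  assume ?L
  then obtain S p where S: "finite S" "card S \<le> k" "p \<in> W s t" "S \<subseteq> set p"
    "\<And>p'. p' \<in> W s t \<Longrightarrow> S \<subseteq> set p' \<Longrightarrow> p' = p"
    by (elim exE conjE) (rule that, assumption+, blast)
  have [simp]: "S \<inter> set p = S" using S(4) by blast
  have "\<exists>k' u' r. jumps k' u' \<and> W u' t = {r} \<and> k' \<le> 0 + card (S \<inter> set p)"
    using S(3) jumps.start by (rule unique_jumps) (simp add: S(5))
  then show ?R using S(2) by (auto intro: order_trans)
next
  assume ?R
  then obtain k' u r where k: "k' \<le> k" "jumps k' u" "W u t = {r}" by blast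
  from jumps_forced[OF k(2)] obtain S q where
    S: "forced S q u" "finite S" "card S \<le> k'" by blast
  have "q @ r \<in> W s t" "S \<subseteq> set (q @ r)" using S(1) k(3) by (force simp: forced_def walks_append)+
  moreover have "\<forall>p'\<in>W s t. S \<subseteq> set p' \<longrightarrow> p' = q @ r"
    using forced_unique[OF S(1) k(3)] by blast
  ultimately show ?L using S(2,3) k(1)
    by (intro exI[of _ S] exI[of _ "q @ r"] conjI) (assumption | rule order_trans)+
qed

text \<open>\<open>f\<close> is a feasible potential for jumps, as in the duality for shortest
  paths, and thus a lower bound for the number of jumps to a vertex.\<close>

lemma jumps_least:
  assumes "f s = 0" "\<And>u a r. u \<in> V \<Longrightarrow> a \<in> E \<Longrightarrow> W u (tail G a) = {r} \<Longrightarrow> f (head G a) \<le> f u + 1"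
    "s \<in> V" "\<And>a. a \<in> E \<Longrightarrow> head G a \<in> V" "jumps k u"
  shows "f u \<le> k \<and> u \<in> V"
  using assms(5)
proof (induction rule: jumps.induct)
  case start
  then show ?case using assms by simp
next
  case (jump k u a r)
  then show ?case using assms(2)[of u a r] assms(4)[of a] by auto
qed

text \<open>A forcing set that misses the segment \<^term>\<open>r @ [a]\<close> would also be contained in the path that
  reroutes this segment.\<close>

lemma forcing_meets_segment:
  assumes "q @ r @ a # p \<in> W s t" "q \<in> W s u" "r @ [a] \<in> W u (head G a)"
    "\<nexists>x. W u (head G a) = {x}"
    "\<And>p'. p' \<in> W s t \<Longrightarrow> S \<subseteq> set p' \<Longrightarrow> p' = q @ r @ a # p"
    "S \<subseteq> set (q @ r @ a # p)" "finite S"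
  shows "card (S \<inter> set q) < card (S \<inter> set (q @ r @ [a]))"
proof -
  from assms(3,4) obtain x where x: "x \<in> W u (head G a)" "x \<noteq> r @ [a]" by blast
  have "p \<in> W (head G a) t" using assms(1) by (auto simp: walks_append walks_Cons)
  then have "q @ x @ p \<in> W s t" using x assms(2) by (auto simp: walks_append)
  then have "\<not> S \<subseteq> set (q @ x @ p)" using assms(5) x(2) by force
  then obtain b where b: "b \<in> S" "b \<notin> set q" "b \<notin> set p" by auto
  then have "b \<in> set (r @ [a])" using assms(6) by auto
  with b show ?thesis using assms(7) by (intro psubset_card_mono) auto
qed

end

section \<open>Incremental counting of walks in the order of the heads\<close>

context pre_digraph
begin

text \<open>As the arcs are sorted by the level of their heads, a walk that uses the arc just appended
  must end with it.\<close>

lemma capped_walks_take: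
  assumes g: "graded_arcs G (set L) d" and L: "sorted (map (d \<circ> head G) L)" "distinct L"
    and i: "i < length L"
  defines "e \<equiv> L ! i"
  shows "capped (walks (set (take (Suc i) L)) u v) =
    (let A = walks (set (take i L)) in
     if v = head G e \<and> capped (A u (tail G e)) \<noteq> 0
     then if capped (A u (tail G e)) < 2 \<and> capped (A u v) < 1 then 1 else 2
     else capped (A u v))"
proof -
  interpret graded_arcs G "set L" d by (rule g)
  have T: "take (Suc i) L = take i L @ [e]" using i by (simp add: take_Suc_conv_app_nth e_def)
  have ne: "e \<notin> set (take i L)"
    using L(2) T by (metis distinct_take not_distinct_conv_prefix)
  \<comment> \<open>The tail of \<open>b\<close> is strictly below its own head, which is at most as
    high as the head of \<open>e\<close>. This is the hypothesis of
    \<open>walks_insert\<close>.\<close>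
  have "tail G b \<noteq> head G e" if "b \<in> insert e (set (take i L))" for b
  proof -
    from that obtain j where j: "j \<le> i" "b = L ! j"
      using i by (auto simp: e_def in_set_conv_nth) (metis less_imp_le)
    have "d (head G b) \<le> d (head G e)"
      using sorted_nth_mono[OF L(1), of j i] j i by (simp add: e_def)
    moreover have "d (tail G b) < d (head G b)" using j i by (intro graded) auto
    ultimately show ?thesis by auto
  qed
  then have *: "walks (set (take (Suc i) L)) u v = walks (set (take i L)) u v \<union>
     (if v = head G e then (\<lambda>p. p @ [e]) ` walks (set (take i L)) u (tail G e) else {})"
    unfolding T by (simp add: walks_insert ne)
  have inj: "inj (\<lambda>p. p @ [e])" by (simp add: inj_def)
  have "walks (set (take i L)) u v \<inter> (\<lambda>p. p @ [e]) ` walks (set (take i L)) u (tail G e) = {}"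
    using ne by (auto simp: walks_def)
  from capped_Un_image[OF inj this] * show ?thesis by (auto simp: Let_def)
qed

end

section \<open>Greedy selection along a given walk\<close>

context graded_arcs
begin

definition pos_vertex :: "'b list \<Rightarrow> nat \<Rightarrow> 'a" where
  "pos_vertex p i = (case i of 0 \<Rightarrow> s | Suc j \<Rightarrow> head G (p ! j))"

definition forces :: "'a \<Rightarrow> 'b list \<Rightarrow> 'b set \<Rightarrow> bool" where
  "forces t p S \<longleftrightarrow> p \<in> W s t \<and> S \<subseteq> set p \<and> (\<forall>p'\<in>W s t. S \<subseteq> set p' \<longrightarrow> p' = p)"

text \<open>Invariant after \<open>i\<close> arcs of \<open>p\<close>: the first \<open>j\<close>
  arcs form closed segments and lead to \<open>u\<close>, and the following ones up to
  \<open>i\<close> form the open segment, still the unique walk between its ends. The last conjunct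
  certifies optimality: every forcing set already has as many arcs among the first \<open>j\<close>
  as have been selected.\<close>

definition greedy :: "'a \<Rightarrow> 'b list \<Rightarrow> nat \<Rightarrow> 'a \<Rightarrow> nat \<Rightarrow> 'b list \<Rightarrow> bool" where
  "greedy t p i u j xs \<longleftrightarrow> j \<le> i \<and> forced (set xs) (take j p) u \<and>
     W u (pos_vertex p i) = {drop j (take i p)} \<and> distinct xs \<and>
     (\<forall>S. forces t p S \<longrightarrow> length xs \<le> card (S \<inter> set (take j p)))"

lemma greedy_init: "greedy t p 0 s 0 []"
  by (simp add: greedy_def forced_start pos_vertex_def walks_refl)

lemma walk_nth:
  assumes "p \<in> W s t" "i < length p"
  shows "p ! i \<in> E" "tail G (p ! i) = pos_vertex p i" "drop (Suc i) p \<in> W (head G (p ! i)) t"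
proof -
  have "take i p @ p ! i # drop (Suc i) p \<in> W s t"
    using assms by (simp add: id_take_nth_drop[symmetric])
  then have *: "p ! i \<in> E" "take i p \<in> W s (tail G (p ! i))"
    "drop (Suc i) p \<in> W (head G (p ! i)) t"
    by (simp_all add: walks_mid)
  then show "p ! i \<in> E" "drop (Suc i) p \<in> W (head G (p ! i)) t" by auto
  show "tail G (p ! i) = pos_vertex p i"
  proof (cases i)
    case 0
    with * have "s = tail G (p ! i)" by (simp add: walks_Nil)
    then show ?thesis unfolding pos_vertex_def by (simp only: 0 nat.case)
  next
    case (Suc j)
    with * assms show ?thesis
      by (simp add: pos_vertex_def take_Suc_conv_app_nth walks_snoc)
  qed
qed

lemma pos_vertex_length: "p \<in> W s t \<Longrightarrow> pos_vertex p (length p) = t"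
  unfolding pos_vertex_def
  by (cases p rule: rev_cases) (auto simp: walks_Nil walks_snoc)

lemma greedy_segment:
  assumes "greedy t p i u j xs" "p \<in> W s t" "i < length p"
  shows "drop j (take i p) @ [p ! i] \<in> W u (head G (p ! i))"
proof -
  have "drop j (take i p) \<in> W u (tail G (p ! i))"
    using assms walk_nth(2)[OF assms(2,3)] by (auto simp: greedy_def)
  then show ?thesis using walk_nth(1)[OF assms(2,3)] by (simp add: walks_snoc)
qed

lemma greedy_keep:
  assumes g: "greedy t p i u j xs" and p: "p \<in> W s t" "i < length p"
    and 1: "capped (W u (head G (p ! i))) = 1"
  shows "greedy t p (Suc i) u j xs"
proof -
  have "drop j (take (Suc i) p) = drop j (take i p) @ [p ! i]"
    using g p(2) by (simp add: greedy_def take_Suc_conv_app_nth)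
  with greedy_segment[OF g p] have "drop j (take (Suc i) p) \<in> W u (head G (p ! i))" by simp
  moreover from 1 obtain x where "W u (head G (p ! i)) = {x}" by (auto simp: capped_eq_1)
  ultimately have "W u (pos_vertex p (Suc i)) = {drop j (take (Suc i) p)}"
    by (simp add: pos_vertex_def)
  then show ?thesis using g by (simp add: greedy_def)
qed

text \<open>The open segment before the arc is unique, so \<open>forced_step\<close> applies to the
  arc. With the arc it is no longer unique, so by \<open>forcing_meets_segment\<close> every forcing
  set has a further arc in it, and the lower bound rises by one as well.\<close>

lemma greedy_cut:
  assumes g: "greedy t p i u j xs" and p: "p \<in> W s t" "i < length p"
    and 1: "capped (W u (head G (p ! i))) \<noteq> 1"
  shows "greedy t p (Suc i) (head G (p ! i)) (Suc i) (xs @ [p ! i])"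
proof -
  let ?a = "p ! i" and ?r = "drop j (take i p)"
  have j: "j \<le> i" and f: "forced (set xs) (take j p) u" and r: "W u (tail G ?a) = {?r}"
    and xs: "distinct xs" "\<And>S. forces t p S \<Longrightarrow> length xs \<le> card (S \<inter> set (take j p))"
    using g walk_nth(2)[OF p] by (auto simp: greedy_def)
  have tk: "take j p @ ?r @ [?a] = take (Suc i) p"
    using p(2) j by (simp add: take_Suc_conv_app_nth)
      (metis append.assoc append_take_drop_id min.absorb1 take_take)
  have whole: "take j p @ ?r @ ?a # drop (Suc i) p = p"
    using tk by (metis append.assoc append_Cons append_Nil append_take_drop_id)
  have "forced (set (xs @ [?a])) (take (Suc i) p) (head G ?a)"
    using forced_step[OF f r walk_nth(1)[OF p]] by (simp add: tk)
  moreover have "?a \<notin> set xs"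
  proof -
    have "set xs \<subseteq> set (take i p)"
      using f j set_take_subset_set_take[of j i p] by (auto simp: forced_def)
    moreover have "?a \<notin> set (take i p)"
      using distinct_walk[OF p(1)] p(2)
      by (metis distinct_take not_distinct_conv_prefix take_Suc_conv_app_nth)
    ultimately show ?thesis by auto
  qed
  moreover have "Suc (length xs) \<le> card (S \<inter> set (take (Suc i) p))" if "forces t p S" for S
  proof -
    have "card (S \<inter> set (take j p)) < card (S \<inter> set (take j p @ ?r @ [?a]))"
    proof (rule forcing_meets_segment)
      show "take j p @ ?r @ ?a # drop (Suc i) p \<in> W s t" using p(1) by (simp only: whole)
      show "take j p \<in> W s u" using f by (simp add: forced_def)
      show "?r @ [?a] \<in> W u (head G ?a)" by (rule greedy_segment[OF g p])
      show "\<nexists>x. W u (head G ?a) = {x}" using 1 by (simp add: capped_eq_1)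
      show "p' = take j p @ ?r @ ?a # drop (Suc i) p" if "p' \<in> W s t" "S \<subseteq> set p'" for p'
        using that \<open>forces t p S\<close> by (simp only: whole) (simp add: forces_def)
      show "S \<subseteq> set (take j p @ ?r @ ?a # drop (Suc i) p)"
        using that by (simp only: whole) (simp add: forces_def)
      show "finite S" using that by (auto simp: forces_def intro: finite_subset)
    qed
    with xs(2)[OF that] show ?thesis by (simp only: tk)
  qed
  ultimately show ?thesis using xs(1) p(2)
    by (simp add: greedy_def pos_vertex_def walks_refl)
qed

text \<open>The segment left open at the end is the unique walk from \<open>u\<close> to
  \<open>t\<close>, so it calls for no further arc.\<close>

lemma greedy_final:
  assumes g: "greedy t p (length p) u j xs" and p: "p \<in> W s t"
  shows "distinct xs" "forces t p (set xs)" "forces t p S \<Longrightarrow> card (set xs) \<le> card S"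
proof -
  have f: "forced (set xs) (take j p) u" "W u t = {drop j p}" "distinct xs"
    using g pos_vertex_length[OF p] by (auto simp: greedy_def)
  show "distinct xs" by (rule f(3))
  have "set xs \<subseteq> set p" using f(1) set_take_subset[of j p] by (auto simp: forced_def)
  moreover have "p' = p" if "p' \<in> W s t" "set xs \<subseteq> set p'" for p'
    using forced_unique[OF f(1,2) that] by simp
  ultimately show "forces t p (set xs)" using p unfolding forces_def by blast
  assume S: "forces t p S"
  then have "finite S" by (auto simp: forces_def intro: finite_subset)
  have "length xs \<le> card (S \<inter> set (take j p))" using g S by (auto simp: greedy_def)
  also have "\<dots> \<le> card S" using \<open>finite S\<close> by (intro card_mono) auto
  finally show "card (set xs) \<le> card S" by (simp add: distinct_card f(3))
qed

end

section \<open>Exploration in the order of distance\<close>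

text \<open>Invariant of Dijkstra's algorithm, with \<open>V\<close> the explored vertices and
  \<open>L\<close> the tight arcs among them. By \<open>frontier\<close>, the next vertex is at
  least as far as all explored ones, which keeps both lists sorted. By \<open>parent\<close>,
  \<open>f v\<close> is the length of a chain of tight arcs from \<open>s\<close> to
  \<open>v\<close>; selecting the whole chain makes it an initial upper bound for the number of
  forcing arcs.\<close>

locale exploration = wf_digraph G for G :: "('a, 'b) pre_digraph" (structure) +
  fixes w :: "'b \<Rightarrow> real" and s :: 'a and V :: "'a list" and L :: "'b list"
    and d :: "'a \<Rightarrow> real" and f :: "'a \<Rightarrow> nat"
  assumes pos: "e \<in> arcs G \<Longrightarrow> 0 < w e"
    and start: "s \<in> set V" "d s = 0" "f s = 0"
    and V: "set V \<subseteq> verts G" "distinct V" "sorted (map d V)"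
    and L: "distinct L" "sorted (map (d \<circ> head G) L)"
    and tight: "e \<in> set L \<longleftrightarrow> e \<in> arcs G \<and> tail G e \<in> set V \<and> head G e \<in> set V \<and>
      d (tail G e) + w e = d (head G e)"
    and relaxed: "e \<in> arcs G \<Longrightarrow> tail G e \<in> set V \<Longrightarrow> head G e \<in> set V \<Longrightarrow>
      d (head G e) \<le> d (tail G e) + w e"
    and frontier: "e \<in> arcs G \<Longrightarrow> tail G e \<in> set V \<Longrightarrow> head G e \<notin> set V \<Longrightarrow> v \<in> set V \<Longrightarrow>
      d v \<le> d (tail G e) + w e"
    and parent: "v \<in> set V \<Longrightarrow> v \<noteq> s \<Longrightarrow> \<exists>e\<in>set L. head G e = v \<and> f v = Suc (f (tail G e))"
begin

lemma exploration_step: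
  assumes b: "b \<in> arcs G" "tail G b \<in> set V" "head G b \<notin> set V"
    and min: "\<And>e. e \<in> arcs G \<Longrightarrow> tail G e \<in> set V \<Longrightarrow> head G e \<notin> set V \<Longrightarrow>
      d (tail G b) + w b \<le> d (tail G e) + w e"
    and as: "set as = arcs G" "distinct as"
    and P: "\<And>e. e \<in> arcs G \<Longrightarrow> P e \<longleftrightarrow>
      head G e = head G b \<and> tail G e \<in> set V \<and> d (tail G e) + w e \<le> d (tail G b) + w b"
  defines "v \<equiv> head G b" and "x \<equiv> d (tail G b) + w b"
  shows "exploration G w s (V @ [v]) (L @ filter P as) (d(v := x)) (f(v := Suc (f (tail G b))))"
proof -
  have v: "v \<notin> set V" "v \<in> verts G" using b by (auto simp: v_def)
  \<comment> \<open>By minimality of \<open>b\<close>, the inequality in \<open>P\<close> amounts to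
    equality, so one comparison of reals recognises the new tight arcs.\<close>
  have P': "e \<in> set (filter P as) \<longleftrightarrow>
      e \<in> arcs G \<and> head G e = v \<and> tail G e \<in> set V \<and> d (tail G e) + w e = x" for e
    using as P[of e] min[of e] b by (auto simp: v_def x_def)
  have Lv: "e \<in> set L \<Longrightarrow> head G e \<in> set V \<and> tail G e \<in> set V" for e using tight by auto
  have le: "u \<in> set V \<Longrightarrow> d u \<le> x" for u using frontier[OF b] by (simp add: x_def)
  have neq: "u \<in> set V \<Longrightarrow> u \<noteq> v" for u using v by auto
  show ?thesis
  proof
    show "s \<in> set (V @ [v])" "(d(v := x)) s = 0" "(f(v := Suc (f (tail G b)))) s = 0"
      using start v by auto
    show "set (V @ [v]) \<subseteq> verts G" "distinct (V @ [v])" using V v by auto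
    have "map (d(v := x)) V = map d V" using v by auto
    then have "sorted (map (d(v := x)) V)" using V by (simp only:)
    then show "sorted (map (d(v := x)) (V @ [v]))"
      using le by (auto simp: sorted_append)
    show "distinct (L @ filter P as)" using L as Lv P' v by auto
    have "map (d(v := x) \<circ> head G) L = map (d \<circ> head G) L" using Lv neq by auto
    then have 1: "sorted (map (d(v := x) \<circ> head G) L)" using L by (simp only:)
    have "map (d(v := x) \<circ> head G) (filter P as) = map (\<lambda>_. x) (filter P as)"
      using P' by (intro map_cong) auto
    then have 2: "sorted (map (d(v := x) \<circ> head G) (filter P as))"
      by (simp only: map_replicate_const sorted_replicate)
    from 1 2 show "sorted (map (d(v := x) \<circ> head G) (L @ filter P as))"
      using le Lv P' by (auto simp: sorted_append)
    show "e \<in> set (L @ filter P as) \<longleftrightarrow> e \<in> arcs G \<and> tail G e \<in> set (V @ [v]) \<and>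
      head G e \<in> set (V @ [v]) \<and> (d(v := x)) (tail G e) + w e = (d(v := x)) (head G e)" for e
    proof (cases "tail G e = v")
      case True
      then have "e \<notin> set (L @ filter P as)" using Lv[of e] P'[of e] v by auto
      \<comment> \<open>An arc leaving \<open>v\<close> has a key beyond \<open>x\<close>, the
        largest distance so far, so it is not tight.\<close>
      moreover have "x + w e \<noteq> d (head G e)" if "e \<in> arcs G" "head G e \<in> set V"
        using pos[OF that(1)] le[OF that(2)] by simp
      ultimately show ?thesis using True pos[of e] by auto
    next
      case False
      then show ?thesis using tight[of e] P'[of e] neq v by auto
    qed
    show "(d(v := x)) (head G e) \<le> (d(v := x)) (tail G e) + w e"
      if "e \<in> arcs G" "tail G e \<in> set (V @ [v])" "head G e \<in> set (V @ [v])" for e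
      using that v pos[of e] relaxed[of e] min[of e] le[of "head G e"]
      by (auto simp: v_def[symmetric] x_def[symmetric])
    show "(d(v := x)) u \<le> (d(v := x)) (tail G e) + w e"
      if "e \<in> arcs G" "tail G e \<in> set (V @ [v])" "head G e \<notin> set (V @ [v])" "u \<in> set (V @ [v])"
      for e u
      using that v pos[of e] frontier[of e u] min[of e] le[of u]
      by (auto simp: v_def[symmetric] x_def[symmetric])
    show "\<exists>e\<in>set (L @ filter P as). head G e = u \<and>
        (f(v := Suc (f (tail G b)))) u = Suc ((f(v := Suc (f (tail G b)))) (tail G e))"
      if "u \<in> set (V @ [v])" "u \<noteq> s" for u
    proof (cases "u = v")
      case True
      have "b \<in> set (filter P as)" using P' b by (auto simp: v_def x_def)
      with True v b show ?thesis by (intro bexI[of _ b]) (auto simp: v_def)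
    next
      case False
      with that parent[of u] obtain e where "e \<in> set L" "head G e = u" "f u = Suc (f (tail G e))"
        by auto
      with False Lv neq show ?thesis by (intro bexI[of _ e]) auto
    qed
  qed (rule pos)
qed

end

lemma (in wf_digraph) exploration_init:
  assumes "\<And>e. e \<in> arcs G \<Longrightarrow> 0 < w e" "s \<in> verts G" "d s = 0" "f s = 0"
  shows "exploration G w s [s] [] d f"
proof
  show "e \<in> set [] \<longleftrightarrow> e \<in> arcs G \<and> tail G e \<in> set [s] \<and>
      head G e \<in> set [s] \<and> d (tail G e) + w e = d (head G e)" for e
    using assms(1)[of e] by auto
  show "d (head G e) \<le> d (tail G e) + w e"
    if "e \<in> arcs G" "tail G e \<in> set [s]" "head G e \<in> set [s]" for e
    using that assms(1)[of e] by auto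
  show "d v \<le> d (tail G e) + w e"
    if "e \<in> arcs G" "tail G e \<in> set [s]" "head G e \<notin> set [s]" "v \<in> set [s]" for e v
    using that assms(1)[of e] by auto
qed (use assms in auto)

section \<open>Completed explorations: tight walks are the shortest paths\<close>

locale full_exploration = exploration +
  assumes closed: "e \<in> arcs G \<Longrightarrow> tail G e \<in> set V \<Longrightarrow> head G e \<in> set V"

sublocale exploration \<subseteq> graded_arcs G "set L" d s
  by unfold_locales (use pos tight in force)

context full_exploration
begin

text \<open>Along the chain of parents every arc is selected; the segments in between are empty and
  unique by \<open>walks_refl\<close>.\<close>

lemma jumps_parent: "v \<in> set V \<Longrightarrow> jumps (f v) v"
proof (induction "f v" arbitrary: v rule: less_induct)
  case less
  show ?case
  proof (cases "v = s")
    case True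
    then show ?thesis using start jumps.start by simp
  next
    case False
    with parent[OF less.prems] obtain e where
      e: "e \<in> set L" "head G e = v" "f v = Suc (f (tail G e))" by auto
    then have "jumps (f (tail G e)) (tail G e)" using tight less.hyps by auto
    from jumps.jump[OF this walks_refl e(1)] e show ?thesis by simp
  qed
qed

lemma walk_ex: "v \<in> set V \<Longrightarrow> W s v \<noteq> {}"
  using jumps_forced[OF jumps_parent] unfolding forced_def by blast

text \<open>The relaxation inequalities telescope along a walk, and their sum is an equality iff
  each of them is, that is, iff all arcs are tight.\<close>

lemma cost_ge_dist:
  "cas u p v \<Longrightarrow> set p \<subseteq> arcs G \<Longrightarrow> u \<in> set V \<Longrightarrow>
    v \<in> set V \<and> d v \<le> d u + awalk_cost w p \<and> (d v = d u + awalk_cost w p \<longleftrightarrow> set p \<subseteq> set L)"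
proof (induction p arbitrary: u)
  case (Cons e p)
  then have e: "e \<in> arcs G" "tail G e = u" "head G e \<in> set V" using closed by auto
  with Cons have IH: "v \<in> set V" "d v \<le> d (head G e) + awalk_cost w p"
    "d v = d (head G e) + awalk_cost w p \<longleftrightarrow> set p \<subseteq> set L" by auto
  have "d (head G e) \<le> d u + w e" "e \<in> set L \<longleftrightarrow> d u + w e = d (head G e)"
    using e Cons.prems tight[of e] relaxed[of e] by auto
  with IH show ?case by auto
qed simp

lemma walk_verts_ge: "p \<in> W u v \<Longrightarrow> x \<in> set (awalk_verts u p) \<Longrightarrow> d u \<le> d x"
proof (induction p arbitrary: u)
  case (Cons e p)
  then show ?case using graded[of e] Cons.IH[of "head G e"] by (force simp: walks_Cons)
qed simp

text \<open>Levels increase strictly along tight arcs. This makes tight walks simple, as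
  \<open>shortest_path\<close> minimises over \<open>apath\<close>.\<close>

lemma distinct_walk_verts: "p \<in> W u v \<Longrightarrow> distinct (awalk_verts u p)"
proof (induction p arbitrary: u)
  case (Cons e p)
  then show ?case using graded[of e] walk_verts_ge[of p "head G e" v "tail G e"]
    by (force simp: walks_Cons)
qed simp

lemma apath_walk: "p \<in> W s v \<Longrightarrow> apath s p v"
  using distinct_walk_verts[of p s v] start V tight
  by (auto simp: apath_def awalk_def walks_def)

text \<open>\<open>d t\<close> is a lower bound for the cost of all paths to \<open>t\<close>,
  attained exactly by tight walks. Some tight walk exists by \<open>walk_ex\<close> once
  \<open>t\<close> is reachable, so every shortest path attains the bound.\<close>

lemma shortest_path_iff: "shortest_path w s t p \<longleftrightarrow> p \<in> W s t"
proof
  assume *: "p \<in> W s t"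
  have "d t = awalk_cost w p"
    using cost_ge_dist[of s p t] * start tight by (auto simp: walks_def)
  moreover have "d t \<le> awalk_cost w q" if "apath s q t" for q
    using cost_ge_dist[of s q t] that start by (auto simp: apath_def awalk_def)
  ultimately show "shortest_path w s t p"
    using apath_walk[OF *] by (force simp: shortest_path_def is_arg_min_def)
next
  assume *: "shortest_path w s t p"
  then have p: "apath s p t" "\<And>q. apath s q t \<Longrightarrow> awalk_cost w p \<le> awalk_cost w q"
    by (force simp: shortest_path_def is_arg_min_def)+
  then have c: "cas s p t" "set p \<subseteq> arcs G" by (auto simp: apath_def awalk_def)
  then have t: "t \<in> set V" using cost_ge_dist start by blast
  then obtain q where q: "q \<in> W s t" using walk_ex by blast
  have "d t = awalk_cost w q"
    using cost_ge_dist[of s q t] q start tight by (auto simp: walks_def)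
  then have "awalk_cost w p \<le> d t" using p(2) apath_walk[OF q] by simp
  then have "set p \<subseteq> set L" using cost_ge_dist[OF c] start by auto
  with c show "p \<in> W s t" by (simp add: walks_def)
qed

lemma forcing_set_for_iff:
  "forcing_set_for w s t p S \<longleftrightarrow>
    p \<in> W s t \<and> S \<subseteq> set p \<and> (\<forall>p'\<in>W s t. S \<subseteq> set p' \<longrightarrow> p' = p)"
  unfolding forcing_set_for_def shortest_path_iff using tight by (auto simp: walks_def)

lemma ex_forcing_set_iff:
  "(\<exists>S\<subseteq>arcs G. forcing_set w s t S \<and> card S \<le> k) \<longleftrightarrow>
    (\<exists>k' u r. k' \<le> k \<and> jumps k' u \<and> W u t = {r})" (is "?L \<longleftrightarrow> _")
proof -
  have "?L \<longleftrightarrow> (\<exists>S p. finite S \<and> card S \<le> k \<and> p \<in> W s t \<and> S \<subseteq> set p \<and>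
      (\<forall>p'\<in>W s t. S \<subseteq> set p' \<longrightarrow> p' = p))" (is "_ \<longleftrightarrow> ?R")
  proof
    assume ?L
    then obtain S p where "forcing_set_for w s t p S" "card S \<le> k"
      by (auto simp: forcing_set_def)
    then show ?R unfolding forcing_set_for_iff
      by (intro exI[of _ S] exI[of _ p]) (auto intro: finite_subset[of _ "set p"])
  next
    assume ?R
    then obtain S p where "card S \<le> k" "forcing_set_for w s t p S"
      unfolding forcing_set_for_iff[symmetric] by blast
    then show ?L unfolding forcing_set_def
      by (intro exI[of _ S]) (auto simp: forcing_set_for_def)
  qed
  then show ?thesis using ex_unique_iff_jumps by simp
qed

end

section \<open>Reasoning about programs\<close>

lemma nats_nset [simp]: "nats (nset a i x \<sigma>) = (nats \<sigma>)(a := (nats \<sigma> a)(i := x))"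
  and reals_nset [simp]: "reals (nset a i x \<sigma>) = reals \<sigma>"
  and nats_rset [simp]: "nats (rset a i y \<sigma>) = nats \<sigma>"
  and reals_rset [simp]: "reals (rset a i y \<sigma>) = (reals \<sigma>)(a := (reals \<sigma> a)(i := y))"
  by (simp_all add: nset_def rset_def)

section \<open>Frame conditions\<close>

primrec nwr :: "com \<Rightarrow> nat set" where
  "nwr Skip = {}"
| "nwr (NSet a i e) = {a}"
| "nwr (RSet a i e) = {}"
| "nwr (Seq c d) = nwr c \<union> nwr d"
| "nwr (Cond b c d) = nwr c \<union> nwr d"
| "nwr (While b c) = nwr c"

primrec rwr :: "com \<Rightarrow> nat set" where
  "rwr Skip = {}"
| "rwr (NSet a i e) = {}"
| "rwr (RSet a i e) = {a}"
| "rwr (Seq c d) = rwr c \<union> rwr d"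
| "rwr (Cond b c d) = rwr c \<union> rwr d"
| "rwr (While b c) = rwr c"

definition same_outside :: "nat set \<Rightarrow> nat set \<Rightarrow> mem \<Rightarrow> mem \<Rightarrow> bool" where
  "same_outside A B \<sigma> \<sigma>' \<longleftrightarrow>
     (\<forall>a. a \<notin> A \<longrightarrow> nats \<sigma>' a = nats \<sigma> a) \<and> (\<forall>b. b \<notin> B \<longrightarrow> reals \<sigma>' b = reals \<sigma> b)"

lemma same_outsideD:
  "same_outside A B \<sigma> \<sigma>' \<Longrightarrow> a \<notin> A \<Longrightarrow> nats \<sigma>' a = nats \<sigma> a"
  "same_outside A B \<sigma> \<sigma>' \<Longrightarrow> b \<notin> B \<Longrightarrow> reals \<sigma>' b = reals \<sigma> b"
  by (simp_all add: same_outside_def)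

lemma exec_same_outside: "exec c \<sigma> \<tau> \<sigma>' \<Longrightarrow> same_outside (nwr c) (rwr c) \<sigma> \<sigma>'"
  by (induction rule: exec.induct) (auto simp: same_outside_def)

primrec nrd :: "nexp \<Rightarrow> nat set" where
  "nrd (NConst c) = {}"
| "nrd (NGet a i) = insert a (nrd i)"
| "nrd (Inc e) = nrd e"
| "nrd (Dec e) = nrd e"

lemma nval_cong: "(\<And>a. a \<in> nrd e \<Longrightarrow> nats \<sigma>' a = nats \<sigma> a) \<Longrightarrow> nval \<sigma>' e = nval \<sigma> e"
  by (induction e) auto

section \<open>Total correctness with time bounds\<close>

definition runs :: "com \<Rightarrow> mem \<Rightarrow> nat \<Rightarrow> (mem \<Rightarrow> bool) \<Rightarrow> bool" where
  "runs c \<sigma> T Q \<longleftrightarrow> (\<exists>\<tau> \<sigma>'. exec c \<sigma> \<tau> \<sigma>' \<and> \<tau> \<le> T \<and> Q \<sigma>')"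

lemma runsI: "exec c \<sigma> \<tau> \<sigma>' \<Longrightarrow> \<tau> \<le> T \<Longrightarrow> Q \<sigma>' \<Longrightarrow> runs c \<sigma> T Q"
  by (auto simp: runs_def)

text \<open>The frame condition is handed on to whoever uses the postcondition, so that
  postconditions need to mention changed arrays only.\<close>

lemma runs_conseq:
  assumes "runs c \<sigma> T Q" "T \<le> T'"
    "\<And>\<sigma>'. Q \<sigma>' \<Longrightarrow> same_outside (nwr c) (rwr c) \<sigma> \<sigma>' \<Longrightarrow> Q' \<sigma>'"
  shows "runs c \<sigma> T' Q'"
  using assms exec_same_outside unfolding runs_def by (meson order_trans)

lemma runs_Seq:
  assumes "runs c \<sigma> T1 P"
    "\<And>\<sigma>'. P \<sigma>' \<Longrightarrow> same_outside (nwr c) (rwr c) \<sigma> \<sigma>' \<Longrightarrow> runs d \<sigma>' T2 Q"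
    "1 + T1 + T2 \<le> T"
  shows "runs (Seq c d) \<sigma> T Q"
proof -
  from assms(1) obtain \<tau> \<sigma>' where 1: "exec c \<sigma> \<tau> \<sigma>'" "\<tau> \<le> T1" "P \<sigma>'"
    by (auto simp: runs_def)
  with assms(2) exec_same_outside[OF 1(1)] obtain \<tau>' \<sigma>'' where
    2: "exec d \<sigma>' \<tau>' \<sigma>''" "\<tau>' \<le> T2" "Q \<sigma>''"
    by (force simp: runs_def)
  from exec.Seq[OF 1(1) 2(1)] show ?thesis
    by (rule runsI) (use 1 2 assms(3) in auto)
qed

lemma runs_Cond:
  assumes "bval \<sigma> b \<Longrightarrow> runs c \<sigma> T1 Q" "\<not> bval \<sigma> b \<Longrightarrow> runs d \<sigma> T1 Q"
    "1 + bcost b + T1 \<le> T"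
  shows "runs (Cond b c d) \<sigma> T Q"
proof (cases "bval \<sigma> b")
  case True
  with assms(1) obtain \<tau> \<sigma>' where 1: "exec c \<sigma> \<tau> \<sigma>'" "\<tau> \<le> T1" "Q \<sigma>'"
    by (auto simp: runs_def)
  from exec.CondTrue[OF True 1(1)] show ?thesis
    by (rule runsI) (use 1 assms(3) in auto)
next
  case False
  with assms(2) obtain \<tau> \<sigma>' where 1: "exec d \<sigma> \<tau> \<sigma>'" "\<tau> \<le> T1" "Q \<sigma>'"
    by (auto simp: runs_def)
  from exec.CondFalse[OF False 1(1)] show ?thesis
    by (rule runsI) (use 1 assms(3) in auto)
qed

primrec loop_free :: "com \<Rightarrow> bool" where
  "loop_free Skip \<longleftrightarrow> True"
| "loop_free (NSet a i e) \<longleftrightarrow> True"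
| "loop_free (RSet a i e) \<longleftrightarrow> True"
| "loop_free (Seq c d) \<longleftrightarrow> loop_free c \<and> loop_free d"
| "loop_free (Cond b c d) \<longleftrightarrow> loop_free c \<and> loop_free d"
| "loop_free (While b c) \<longleftrightarrow> False"

text \<open>A functional semantics for loop-free code. With the worst-case cost
  \<open>maxcost\<close>, it lets simplification replace derivations of \<open>exec\<close>.\<close>

primrec eff :: "com \<Rightarrow> mem \<Rightarrow> mem" where
  "eff Skip \<sigma> = \<sigma>"
| "eff (NSet a i e) \<sigma> = nset a (nval \<sigma> i) (nval \<sigma> e) \<sigma>"
| "eff (RSet a i e) \<sigma> = rset a (nval \<sigma> i) (rval \<sigma> e) \<sigma>"
| "eff (Seq c d) \<sigma> = eff d (eff c \<sigma>)"
| "eff (Cond b c d) \<sigma> = (if bval \<sigma> b then eff c \<sigma> else eff d \<sigma>)"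
| "eff (While b c) \<sigma> = \<sigma>"

primrec maxcost :: "com \<Rightarrow> nat" where
  "maxcost Skip = 1"
| "maxcost (NSet a i e) = 1 + ncost i + ncost e"
| "maxcost (RSet a i e) = 1 + ncost i + rcost e"
| "maxcost (Seq c d) = 1 + maxcost c + maxcost d"
| "maxcost (Cond b c d) = 1 + bcost b + max (maxcost c) (maxcost d)"
| "maxcost (While b c) = 0"

lemma exec_loop_free: "loop_free c \<Longrightarrow> \<exists>\<tau>\<le>maxcost c. exec c \<sigma> \<tau> (eff c \<sigma>)"
proof (induction c arbitrary: \<sigma>)
  case Skip
  then show ?case using exec.Skip[of \<sigma>] by auto
next
  case (Seq c d)
  then obtain \<tau> \<tau>' where "exec c \<sigma> \<tau> (eff c \<sigma>)" "\<tau> \<le> maxcost c"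
    "exec d (eff c \<sigma>) \<tau>' (eff d (eff c \<sigma>))" "\<tau>' \<le> maxcost d" by (metis loop_free.simps(4))
  then show ?case using exec.Seq[of c \<sigma> \<tau> "eff c \<sigma>" d \<tau>' "eff d (eff c \<sigma>)"]
    by (intro exI[of _ "1 + \<tau> + \<tau>'"]) simp
next
  case (Cond b c d)
  show ?case
  proof (cases "bval \<sigma> b")
    case True
    from Cond obtain \<tau> where "exec c \<sigma> \<tau> (eff c \<sigma>)" "\<tau> \<le> maxcost c" by fastforce
    with True show ?thesis
      by (intro exI[of _ "1 + bcost b + \<tau>"]) (auto intro: exec.CondTrue[simplified])
  next
    case False
    from Cond obtain \<tau> where "exec d \<sigma> \<tau> (eff d \<sigma>)" "\<tau> \<le> maxcost d" by fastforce
    with False show ?thesis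
      by (intro exI[of _ "1 + bcost b + \<tau>"]) (auto intro: exec.CondFalse[simplified])
  qed
qed (auto intro: exec.intros exec.NSet[simplified] exec.RSet[simplified])

lemma runs_loop_free:
  assumes "loop_free c" "Q (eff c \<sigma>)" "maxcost c \<le> T"
  shows "runs c \<sigma> T Q"
  using exec_loop_free[OF assms(1), of \<sigma>] assms(2,3) unfolding runs_def by (meson order_trans)

abbreviation "Var a \<equiv> NGet a (NConst 0)"

text \<open>The bound \<open>N\<close> is evaluated anew at every test, whence the conditions on
  \<open>nrd N\<close> in \<open>runs_For\<close>.\<close>

definition For :: "nat \<Rightarrow> nexp \<Rightarrow> com \<Rightarrow> com" where
  "For x N c = Seq (NSet x (NConst 0) (NConst 0))
     (While (NLess (Var x) N) (Seq c (NSet x (NConst 0) (Inc (Var x)))))"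

lemma wr_For [simp]: "nwr (For x N c) = insert x (nwr c)" "rwr (For x N c) = rwr c"
  by (auto simp: For_def)

text \<open>\<open>I i\<close> describes the memory in which the counter is already
  \<open>i\<close>. Beside the body, a round costs \<open>ncost N + 4\<close> for the loop and its
  test and 6 for sequencing and increment; the initialisation costs 4 and the last test
  \<open>ncost N + 4\<close>.\<close>

lemma runs_For:
  assumes n: "nval \<sigma> N = n" and x: "x \<notin> nrd N" "x \<notin> nwr c" and N: "nrd N \<inter> nwr c = {}"
    and I0: "I 0 (nset x 0 0 \<sigma>)"
    and step: "\<And>i \<sigma>'. i < n \<Longrightarrow> I i \<sigma>' \<Longrightarrow> nats \<sigma>' x 0 = i \<Longrightarrow>
      same_outside (insert x (nwr c)) (rwr c) \<sigma> \<sigma>' \<Longrightarrow>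
      runs c \<sigma>' B (\<lambda>\<sigma>''. I (Suc i) (nset x 0 (Suc i) \<sigma>''))"
    and T: "n * (B + ncost N + 10) + ncost N + 8 \<le> T"
  shows "runs (For x N c) \<sigma> T (I n)"
proof -
  let ?b = "NLess (Var x) N" and ?c = "Seq c (NSet x (NConst 0) (Inc (Var x)))"
  let ?S = "same_outside (insert x (nwr c)) (rwr c) \<sigma>"
  have *: "\<exists>\<tau> \<sigma>''. exec (While ?b ?c) \<sigma>' \<tau> \<sigma>'' \<and>
      \<tau> \<le> k * (B + ncost N + 10) + ncost N + 4 \<and> I n \<sigma>''"
    if "i + k = n" "I i \<sigma>'" "nats \<sigma>' x 0 = i" "?S \<sigma>'" for k i \<sigma>'
    using that
  proof (induction k arbitrary: i \<sigma>')
    case 0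
    have "nval \<sigma>' N = n"
      using 0(4) x N n nval_cong[of N \<sigma>' \<sigma>] by (force simp: same_outside_def)
    then have "\<not> bval \<sigma>' ?b" using 0 by simp
    from exec.WhileFalse[OF this] 0 show ?case by fastforce
  next
    case (Suc k)
    have "nval \<sigma>' N = n"
      using Suc(5) x N n nval_cong[of N \<sigma>' \<sigma>] by (force simp: same_outside_def)
    then have b: "bval \<sigma>' ?b" using Suc.prems by simp
    from Suc.prems step[of i \<sigma>'] obtain \<tau>1 \<sigma>1 where
      1: "exec c \<sigma>' \<tau>1 \<sigma>1" "\<tau>1 \<le> B" "I (Suc i) (nset x 0 (Suc i) \<sigma>1)"
      by (auto simp: runs_def)
    have S: "same_outside (nwr c) (rwr c) \<sigma>' \<sigma>1" using exec_same_outside[OF 1(1)] .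
    then have "nats \<sigma>1 x 0 = i" using x(2) Suc.prems by (simp add: same_outside_def)
    then have 2: "exec ?c \<sigma>' (1 + \<tau>1 + 5) (nset x 0 (Suc i) \<sigma>1)"
      using exec.Seq[OF 1(1) exec.NSet[of x "NConst 0" "Inc (Var x)" \<sigma>1]]
      by (simp add: eval_nat_numeral)
    have "?S (nset x 0 (Suc i) \<sigma>1)"
      using S Suc.prems by (auto simp: same_outside_def)
    then obtain \<tau>2 \<sigma>2 where
      3: "exec (While ?b ?c) (nset x 0 (Suc i) \<sigma>1) \<tau>2 \<sigma>2"
        "\<tau>2 \<le> k * (B + ncost N + 10) + ncost N + 4" "I n \<sigma>2"
      using Suc.IH[of "Suc i" "nset x 0 (Suc i) \<sigma>1"] 1(3) Suc.prems(1) by auto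
    from exec.WhileTrue[OF b 2 3(1)] 1(2) 3(2,3) show ?case
      by (intro exI conjI) (assumption, simp_all)
  qed
  have "?S (nset x 0 0 \<sigma>)" by (auto simp: same_outside_def)
  with *[of 0 n "nset x 0 0 \<sigma>"] I0 obtain \<tau> \<sigma>'' where
    1: "exec (While ?b ?c) (nset x 0 0 \<sigma>) \<tau> \<sigma>''"
      "\<tau> \<le> n * (B + ncost N + 10) + ncost N + 4" "I n \<sigma>''" by auto
  have "exec (For x N c) \<sigma> (1 + 3 + \<tau>) \<sigma>''"
    using exec.Seq[OF exec.NSet[of x "NConst 0" "NConst 0" \<sigma>], of _ \<tau> \<sigma>''] 1(1)
    by (simp add: For_def eval_nat_numeral)
  with 1 T show ?thesis unfolding runs_def by (intro exI[of _ "1 + 3 + \<tau>"] exI conjI) auto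
qed

section \<open>The programs\<close>

text \<open>
  Beside the input and output arrays, the programs use number arrays for the counters of outer and
  inner loops (6, 7), the marks of explored vertices (8), the best arc plus one (9, where 0 means
  none), the explored vertices and their number (10, 11), the tight arcs and their number (12, 13),
  upper bounds for the number of forcing arcs (14), capped walk counts (15), the source of the
  current sweep (16), and real array 2 for distances.
\<close>

definition sweep :: com where
  "sweep = (let a = NGet 12 (Var 7); x = NGet 1 a; y = NGet 2 a in
     Seq (NSet 15 (NGet 0 (NConst 3)) (NConst 0))
    (Seq (For 7 (Var 13) (Seq (NSet 15 x (NConst 0)) (NSet 15 y (NConst 0))))
    (Seq (NSet 15 (Var 16) (NConst 1))
         (For 7 (Var 13)
           (Cond (NLess (NConst 0) (NGet 15 x))
             (Cond (BAnd (NLess (NGet 15 x) (NConst 2)) (NLess (NGet 15 y) (NConst 1)))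
               (NSet 15 y (NConst 1)) (NSet 15 y (NConst 2)))
             Skip)))))"

lemma wr_sweep [simp]: "nwr sweep = {7, 15}" "rwr sweep = {}"
  by (auto simp: sweep_def Let_def)

lemma runs_sweep:
  fixes G :: "(nat, nat) pre_digraph"
  assumes g: "graded_arcs G (set L) d" and L: "sorted (map (d \<circ> head G) L)" "distinct L"
    and mem: "nats \<sigma> 13 0 = length L" "\<And>i. i < length L \<Longrightarrow> nats \<sigma> 12 i = L ! i"
      "\<And>e. e \<in> set L \<Longrightarrow> nats \<sigma> 1 e = tail G e \<and> nats \<sigma> 2 e = head G e"
      "nats \<sigma> 16 0 = u" "nats \<sigma> 0 3 = t"
    and T: "100 * length L + 100 \<le> T"
  shows "runs sweep \<sigma> T (\<lambda>\<sigma>'. \<forall>v\<in>tail G ` set L \<union> head G ` set L \<union> {t, u}.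
    nats \<sigma>' 15 v = capped (pre_digraph.walks G (set L) u v))"
proof -
  interpret graded_arcs G "set L" d by (rule g)
  let ?l = "length L"
  define Z where "Z = tail G ` set L \<union> head G ` set L \<union> {t, u}"
  define c where "c i v = capped (walks (set (take i L)) u v)" for i v
  \<comment> \<open>\<open>?I\<close> belongs to the clearing loop. \<open>?J\<close> belongs to the
    counting loop and refers to walks in the first \<open>i\<close> tight arcs;
    \<open>capped_walks_take\<close> is its induction step.\<close>
  let ?I = "\<lambda>i \<sigma>'. nats \<sigma>' 15 t = 0 \<and> (\<forall>j<i. nats \<sigma>' 15 (tail G (L ! j)) = 0 \<and>
    nats \<sigma>' 15 (head G (L ! j)) = 0)"
  let ?J = "\<lambda>i \<sigma>'. \<forall>v\<in>Z. nats \<sigma>' 15 v = c i v"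
  have c_Suc: "c (Suc i) v =
    (if v = head G (L ! i) \<and> c i (tail G (L ! i)) \<noteq> 0
     then if c i (tail G (L ! i)) < 2 \<and> c i v < 1 then 1 else 2 else c i v)"
    if "i < ?l" for i v
    using capped_walks_take[OF g L that] by (simp add: c_def Let_def)
  have post: "(\<forall>v\<in>tail G ` set L \<union> head G ` set L \<union> {t, u}.
      nats \<sigma>' 15 v = capped (walks (set L) u v)) \<longleftrightarrow> ?J ?l \<sigma>'" for \<sigma>'
    by (simp only: Z_def c_def take_all order_refl)
  have L': "nats \<sigma> 1 (L ! i) = tail G (L ! i)" "nats \<sigma> 2 (L ! i) = head G (L ! i)"
    if "i < ?l" for i using mem(3)[of "L ! i"] that by auto
  show ?thesis
    unfolding sweep_def Let_def post
  proof (rule runs_Seq[OF runs_loop_free[where Q = "?I 0" and T = 10], where ?T2.0 = "90 * ?l + 80"],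
      goal_cases)
    case (4 \<sigma>1)
    note [simp] = same_outsideD[OF 4(2)]
    show ?case
    proof (rule runs_Seq[OF runs_For[where n = ?l and I = ?I and B = 20 and T = "32 * ?l + 10"],
        where ?T2.0 = "57 * ?l + 60"], goal_cases)
      case (6 i \<sigma>2)
      note [simp] = same_outsideD[OF 6(4)]
      show ?case using 6
        by (intro runs_loop_free) (simp_all add: mem(1,2) L'[unfolded One_nat_def] less_Suc_eq all_conj_distrib)
    next
      case (8 \<sigma>2)
      note [simp] = same_outsideD[OF 8(2)]
      show ?case
      proof (rule runs_Seq[OF runs_loop_free[where Q = "?J 0" and T = 5], where ?T2.0 = "57 * ?l + 50"],
          goal_cases)
        case 2
        have "nats \<sigma>2 15 v = 0" if "v \<in> Z" "v \<noteq> u" for v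
          using that 8 by (auto simp: in_set_conv_nth Z_def)
        then show ?case by (auto simp: mem walks_empty c_def)
      next
        case (4 \<sigma>3)
        note [simp] = same_outsideD[OF 4(2)]
        show ?case
        proof (rule runs_conseq[OF runs_For[where n = ?l and I = ?J and B = 45 and T = "57 * ?l + 10"]],
            goal_cases)
          case (6 i \<sigma>4)
          note [simp] = same_outsideD[OF 6(4)]
          have Z: "tail G (L ! i) \<in> Z" "head G (L ! i) \<in> Z" using 6(1) by (auto simp: Z_def)
          show ?case
            using 6(1-3) Z by (intro runs_loop_free)
              (simp_all add: mem(1,2) L'[unfolded One_nat_def] c_Suc[OF 6(1)])
        qed (use 4 in \<open>simp_all add: mem\<close>)
      qed (auto simp: mem intro: le_refl)
    qed (use 4 in \<open>auto simp: mem\<close>)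
  qed (use T in \<open>simp_all add: mem(5)\<close>)
qed

text \<open>Weaker than equality with \<open>input_mem\<close>: only arrays that the programs never
  write are mentioned, so it survives every phase. \<open>Suc 0\<close> is the simplifier's normal
  form of the index 1.\<close>

definition is_input :: "(nat, nat) pre_digraph \<Rightarrow> (nat \<Rightarrow> real) \<Rightarrow> nat \<Rightarrow> nat \<Rightarrow> nat \<Rightarrow> mem \<Rightarrow> bool" where
  "is_input G w s t k \<sigma> \<longleftrightarrow>
     nats \<sigma> 0 0 = card (verts G) \<and> nats \<sigma> 0 (Suc 0) = card (arcs G) \<and>
     nats \<sigma> 0 2 = s \<and> nats \<sigma> 0 3 = t \<and> nats \<sigma> 0 4 = k \<and>
     (\<forall>e\<in>arcs G. nats \<sigma> (Suc 0) e = tail G e \<and> nats \<sigma> 2 e = head G e \<and> reals \<sigma> 0 e = w e)"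

lemma is_input_same_outside:
  "is_input G w s t k \<sigma> \<Longrightarrow> same_outside A B \<sigma> \<sigma>' \<Longrightarrow> A \<inter> {0, 1, 2} = {} \<Longrightarrow> 0 \<notin> B \<Longrightarrow>
    is_input G w s t k \<sigma>'"
  by (auto simp: is_input_def same_outside_def)

definition holds_exploration ::
  "(nat, nat) pre_digraph \<Rightarrow> (nat \<Rightarrow> real) \<Rightarrow> nat \<Rightarrow> nat list \<Rightarrow> nat list \<Rightarrow> mem \<Rightarrow> bool" where
  "holds_exploration G w s V L \<sigma> \<longleftrightarrow>
     exploration G w s V L (reals \<sigma> 2) (nats \<sigma> 14) \<and>
     nats \<sigma> 11 0 = length V \<and> (\<forall>i<length V. nats \<sigma> 10 i = V ! i) \<and>
     nats \<sigma> 13 0 = length L \<and> (\<forall>i<length L. nats \<sigma> 12 i = L ! i) \<and>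
     (\<forall>v. nats \<sigma> 8 v = (if v \<in> set V then 1 else 0))"

abbreviation "key e \<equiv> RAdd (RGet 2 (NGet 1 e)) (RGet 0 e)"

text \<open>While cell 0 of array 9 is 0, \<open>Dec\<close> truncates and \<open>b\<close> denotes
  arc 0; the comparison of keys is then masked by the test that the cell is positive.\<close>

definition scan :: com where
  "scan = (let e = Var 7; b = Dec (Var 9) in
     Cond (BAnd (BAnd (NLess (NConst 0) (NGet 8 (NGet 1 e))) (NLess (NGet 8 (NGet 2 e)) (NConst 1)))
          (BNot (BAnd (NLess (NConst 0) (Var 9)) (BNot (RLess (key e) (key b))))))
       (NSet 9 (NConst 0) (Inc e)) Skip)"

definition append_vertex :: com where
  "append_vertex = (let b = Dec (Var 9); v = NGet 2 b in
     Seq (RSet 2 v (key b))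
    (Seq (NSet 14 v (Inc (NGet 14 (NGet 1 b))))
    (Seq (NSet 10 (Var 11) v)
         (NSet 11 (NConst 0) (Inc (Var 11))))))"

definition collect :: com where
  "collect = (let e = Var 7; v = NGet 2 (Dec (Var 9)) in
     Cond (BAnd (BAnd (BNot (NLess (NGet 2 e) v)) (BNot (NLess v (NGet 2 e))))
          (BAnd (NLess (NConst 0) (NGet 8 (NGet 1 e))) (BNot (RLess (RGet 2 v) (key e)))))
       (Seq (NSet 12 (Var 13) e) (NSet 13 (NConst 0) (Inc (Var 13)))) Skip)"

text \<open>The new vertex is marked only after \<open>collect\<close>, so that during collection
  the marks still denote the old \<open>V\<close>, as the predicate \<open>P\<close> in
  \<open>exploration_step\<close> demands.\<close>

definition explore_round :: com where
  "explore_round =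
     Seq (NSet 9 (NConst 0) (NConst 0))
    (Seq (For 7 (NGet 0 (NConst 1)) scan)
         (Cond (NLess (NConst 0) (Var 9))
           (Seq append_vertex
           (Seq (For 7 (NGet 0 (NConst 1)) collect)
                (NSet 8 (NGet 2 (Dec (Var 9))) (NConst 1))))
           Skip))"

definition explore :: com where
  "explore =
     Seq (Seq (NSet 8 (NGet 0 (NConst 2)) (NConst 1))
         (Seq (NSet 10 (NConst 0) (NGet 0 (NConst 2))) (NSet 11 (NConst 0) (NConst 1))))
       (For 6 (NGet 0 (NConst 0)) explore_round)"

lemma wr_scan [simp]: "nwr scan = {9}" "rwr scan = {}"
  by (simp_all add: scan_def Let_def)

lemma wr_append_vertex [simp]: "nwr append_vertex = {10, 11, 14}" "rwr append_vertex = {2}"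
  by (auto simp: append_vertex_def Let_def)

lemma wr_collect [simp]: "nwr collect = {12, 13}" "rwr collect = {}"
  by (auto simp: collect_def Let_def)

lemma wr_explore_round [simp]:
  "nwr explore_round = {7, 8, 9, 10, 11, 12, 13, 14}" "rwr explore_round = {2}"
  by (auto simp: explore_round_def)

lemma wr_explore [simp]:
  "nwr explore = {6, 7, 8, 9, 10, 11, 12, 13, 14}" "rwr explore = {2}"
  by (auto simp: explore_def)

text \<open>The second alternative records that some arc left \<open>V\<close>. It thus excludes a
  closed \<open>V\<close>, so closedness persists through the remaining rounds.\<close>

lemma runs_explore_round:
  assumes G: "numbered_digraph G" and inp: "is_input G w s t k \<sigma>"
    and E: "holds_exploration G w s V L \<sigma>"
    and T: "200 * card (arcs G) + 200 \<le> T"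
  shows "runs explore_round \<sigma> T (\<lambda>\<sigma>'. \<exists>V' L'. holds_exploration G w s V' L' \<sigma>' \<and>
    ((\<forall>e\<in>arcs G. tail G e \<in> set V' \<longrightarrow> head G e \<in> set V') \<or>
     length V' = Suc (length V) \<and> (\<exists>e\<in>arcs G. tail G e \<in> set V \<and> head G e \<notin> set V)))"
proof -
  let ?m = "card (arcs G)" and ?d = "reals \<sigma> 2" and ?f = "nats \<sigma> 14"
  interpret exploration G w s V L ?d ?f using E by (simp add: holds_exploration_def)
  have arcs: "e \<in> arcs G \<longleftrightarrow> e < ?m" for e
    using G unfolding numbered_digraph_def by (metis lessThan_iff)
  have mem: "nats \<sigma> 11 0 = length V" "\<And>i. i < length V \<Longrightarrow> nats \<sigma> 10 i = V ! i"
    "nats \<sigma> 13 0 = length L" "\<And>i. i < length L \<Longrightarrow> nats \<sigma> 12 i = L ! i"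
    "\<And>v. nats \<sigma> 8 v = (if v \<in> set V then 1 else 0)"
    using E by (auto simp: holds_exploration_def)
  have inp': "nats \<sigma> 0 (Suc 0) = ?m"
    "\<And>e. e < ?m \<Longrightarrow> nats \<sigma> (Suc 0) e = tail G e"
    "\<And>e. e < ?m \<Longrightarrow> nats \<sigma> 2 e = head G e" "\<And>e. e < ?m \<Longrightarrow> reals \<sigma> 0 e = w e"
    using inp by (auto simp: is_input_def arcs)
  define Fr where "Fr e \<longleftrightarrow> e < ?m \<and> tail G e \<in> set V \<and> head G e \<notin> set V" for e
  define kv where "kv e = ?d (tail G e) + w e" for e
  let ?best = "\<lambda>i \<sigma>'. (nats \<sigma>' 9 0 = 0 \<and> (\<forall>e<i. \<not> Fr e)) \<or>
    (\<exists>b. nats \<sigma>' 9 0 = Suc b \<and> Fr b \<and> (\<forall>e<i. Fr e \<longrightarrow> kv b \<le> kv e))"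
  show ?thesis
    unfolding explore_round_def
  proof (rule runs_Seq[OF runs_loop_free[where Q = "?best 0" and T = 5],
      where ?T2.0 = "200 * ?m + 190"], goal_cases)
    case (4 \<sigma>1)
    note [simp] = same_outsideD[OF 4(2)]
    show ?case
    proof (rule runs_Seq[OF runs_For[where n = ?m and I = ?best and B = 60
          and T = "80 * ?m + 20"], where ?T2.0 = "120 * ?m + 160"], goal_cases)
      case (6 i \<sigma>2)
      note [simp] = same_outsideD[OF 6(4)]
      have *: "Fr i \<longleftrightarrow> tail G i \<in> set V \<and> head G i \<notin> set V" using 6(1) by (simp add: Fr_def)
      from 6(2) show ?case
      proof (elim disjE exE conjE, goal_cases)
        case 1
        then show ?case using 6(1,3)
          by (intro runs_loop_free)
            (auto simp: scan_def Let_def mem(5) inp' * less_Suc_eq)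
      next
        case (2 b)
        have b: "b < ?m" using 2 by (simp add: Fr_def)
        show ?case using 2 6(1,3) b
          by (intro runs_loop_free)
            (auto simp: scan_def Let_def mem(5) inp' * less_Suc_eq kv_def)
      qed
    next
      case (8 \<sigma>2)
      note [simp] = same_outsideD[OF 8(2)]
      show ?case
      proof (rule runs_Cond[where ?T1.0 = "120 * ?m + 150"], goal_cases)
        case 2
        then have "\<And>e. e < ?m \<Longrightarrow> \<not> Fr e" using 8(1) by auto
        then have closed: "\<forall>e\<in>arcs G. tail G e \<in> set V \<longrightarrow> head G e \<in> set V"
          by (auto simp: Fr_def arcs)
        have "holds_exploration G w s V L \<sigma>2"
          using E by (simp add: holds_exploration_def)
        with closed show ?case by (intro runs_loop_free) auto
      next
        case 1
        with 8(1) obtain b where b: "nats \<sigma>2 9 0 = Suc b" "Fr b"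
          "\<And>e. Fr e \<Longrightarrow> kv b \<le> kv e" by (auto simp: Fr_def)
        have bm: "b < ?m" using b(2) by (simp add: Fr_def)
        define v where "v = head G b"
        define d' where "d' = ?d(v := kv b)"
        define f' where "f' = ?f(v := Suc (?f (tail G b)))"
        define P where "P e \<longleftrightarrow> head G e = v \<and> tail G e \<in> set V \<and> kv e \<le> kv b" for e
        \<comment> \<open>The list of tight arcs after \<open>collect\<close> has treated the arcs
          below \<open>i\<close>; at \<open>?m\<close> it is the list of
          \<open>exploration_step\<close>.\<close>
        define L' where "L' i = L @ filter P [0..<i]" for i
        have v: "v \<notin> set V" using b(2) by (simp add: Fr_def v_def)
        have "exploration G w s (V @ [v]) (L' ?m) d' f'"
          unfolding v_def d'_def f'_def L'_def kv_def
          by (rule exploration_step)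
            (use b bm in \<open>auto simp: Fr_def P_def kv_def v_def arcs\<close>)
        moreover have L'_Suc: "L' (Suc i) = L' i @ (if P i then [i] else [])" for i
          by (simp add: L'_def)
        let ?A = "\<lambda>\<sigma>'. reals \<sigma>' 2 = d' \<and> nats \<sigma>' 14 = f' \<and> nats \<sigma>' 11 0 = length (V @ [v]) \<and>
          (\<forall>i<length (V @ [v]). nats \<sigma>' 10 i = (V @ [v]) ! i)"
        let ?I = "\<lambda>i \<sigma>'. nats \<sigma>' 13 0 = length (L' i) \<and> (\<forall>j<length (L' i). nats \<sigma>' 12 j = L' i ! j)"
        show ?case
        proof (rule runs_Seq[OF runs_loop_free[where Q = ?A and T = 50],
              where ?T2.0 = "120 * ?m + 90"], goal_cases)
          case 2
          show ?case using b(1) bm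
            by (auto simp: append_vertex_def Let_def inp' mem v_def d'_def f'_def kv_def nth_append less_Suc_eq)
        next
          case (4 \<sigma>3)
          note [simp] = same_outsideD[OF 4(2)]
          show ?case
          proof (rule runs_Seq[OF runs_For[where n = ?m and I = ?I and B = 60
                and T = "80 * ?m + 20"], where ?T2.0 = "40 * ?m + 60"], goal_cases)
            case 5
            then show ?case by (simp add: L'_def mem)
          next
            case (6 i \<sigma>4)
            note [simp] = same_outsideD[OF 6(4)]
            have "tail G i \<in> set V \<Longrightarrow> d' (tail G i) = ?d (tail G i)"
              using v by (auto simp: d'_def)
            moreover have "d' v = kv b" by (simp add: d'_def)
            ultimately show ?case using b(1) bm 6(1-3) 4(1)
              by (intro runs_loop_free) (auto simp: collect_def Let_def inp' mem(5) v_def[symmetric]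
                P_def kv_def L'_Suc nth_append less_Suc_eq)
          next
            case (8 \<sigma>4)
            note [simp] = same_outsideD[OF 8(2)]
            have "holds_exploration G w s (V @ [v]) (L' ?m) (nset 8 v 1 \<sigma>4)"
              using 8(1) 4(1) calculation v unfolding holds_exploration_def
              by (auto simp: mem(5))
            moreover have "\<exists>e\<in>arcs G. tail G e \<in> set V \<and> head G e \<notin> set V"
              using b(2) by (auto simp: Fr_def arcs)
            ultimately show ?case using b(1) bm
              by (intro runs_loop_free exI[of _ "V @ [v]"] exI[of _ "L' ?m"])
                (simp_all add: inp' v_def)
          qed (simp_all add: inp' collect_def Let_def)
        qed (simp_all add: append_vertex_def Let_def)
      qed simp
    qed (use 4 in \<open>simp_all add: inp' scan_def Let_def\<close>)
  qed (use T in simp_all)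
qed

text \<open>Each round adds a vertex unless \<open>V\<close> is closed, and \<open>V\<close> is a
  distinct list of vertices, so \<open>n\<close> rounds suffice.\<close>

lemma runs_explore:
  assumes G: "numbered_digraph G" "s \<in> verts G" "\<And>e. e \<in> arcs G \<Longrightarrow> 0 < w e"
    and inp: "is_input G w s t k \<sigma>"
    and zero: "\<And>v. nats \<sigma> 8 v = 0" "nats \<sigma> 13 0 = 0" "nats \<sigma> 14 s = 0" "reals \<sigma> 2 s = 0"
    and T: "card (verts G) * (200 * card (arcs G) + 220) + 50 \<le> T"
  shows "runs explore \<sigma> T (\<lambda>\<sigma>'. \<exists>V L. holds_exploration G w s V L \<sigma>' \<and>
    full_exploration G w s V L (reals \<sigma>' 2) (nats \<sigma>' 14))"
proof -
  interpret fin_digraph G using G(1) by (simp add: numbered_digraph_def)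
  let ?n = "card (verts G)"
  let ?closed = "\<lambda>V. \<forall>e\<in>arcs G. tail G e \<in> set V \<longrightarrow> head G e \<in> set V"
  let ?I = "\<lambda>i \<sigma>'. \<exists>V L. holds_exploration G w s V L \<sigma>' \<and> (?closed V \<or> i < length V)"
  have holds_nset: "holds_exploration G w s V L (nset 6 x y \<tau>) = holds_exploration G w s V L \<tau>"
    for V L x y \<tau> by (simp add: holds_exploration_def)
  have final: "\<exists>V L. holds_exploration G w s V L \<sigma>' \<and>
    full_exploration G w s V L (reals \<sigma>' 2) (nats \<sigma>' 14)" if I: "?I ?n \<sigma>'" for \<sigma>'
  proof -
    from I obtain V L where VL: "holds_exploration G w s V L \<sigma>'" "?closed V \<or> ?n < length V"
      by blast
    then have E: "exploration G w s V L (reals \<sigma>' 2) (nats \<sigma>' 14)"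
      by (simp add: holds_exploration_def)
    have "length V \<le> ?n"
      using exploration.V(1,2)[OF E] by (metis card_mono distinct_card finite_verts)
    with VL have "?closed V" by auto
    with E have "full_exploration G w s V L (reals \<sigma>' 2) (nats \<sigma>' 14)"
      by (intro full_exploration.intro full_exploration_axioms.intro) auto
    with VL show ?thesis by blast
  qed
  show ?thesis
    unfolding explore_def
  proof (rule runs_Seq[OF runs_loop_free[where Q = "?I 0" and T = 20],
      where ?T2.0 = "?n * (200 * card (arcs G) + 220) + 20"], goal_cases)
    case 2
    have "exploration G w s [s] [] (reals \<sigma> 2) (nats \<sigma> 14)"
      using G zero by (intro exploration_init) auto
    then have "holds_exploration G w s [s] [] (nset 11 0 1 (nset 10 0 s (nset 8 s 1 \<sigma>)))"
      using zero by (simp add: holds_exploration_def)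
    then show ?case using inp by (intro exI[of _ "[s]"] exI[of _ "[]"]) (simp add: is_input_def)
  next
    case (4 \<sigma>1)
    note [simp] = same_outsideD[OF 4(2)]
    show ?case
    proof (rule runs_conseq[OF runs_For[where n = ?n and I = ?I and B = "200 * card (arcs G) + 208"
            and T = "?n * (200 * card (arcs G) + 220) + 20"]], goal_cases)
      case 5
      show ?case using 4(1) by (simp add: holds_nset)
    next
      case (6 i \<sigma>2)
      from 6(2) obtain V L where
        VL: "holds_exploration G w s V L \<sigma>2" "?closed V \<or> i < length V" by blast
      have "is_input G w s t k \<sigma>2"
        using is_input_same_outside[OF is_input_same_outside[OF inp 4(2)] 6(4)] by auto
      from runs_explore_round[OF G(1) this VL(1) order_refl]
      show ?case
      proof (rule runs_conseq, goal_cases)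
        case (2 \<sigma>3)
        then obtain V' L' where VL': "holds_exploration G w s V' L' \<sigma>3"
          "?closed V' \<or> length V' = Suc (length V) \<and> \<not> ?closed V" by blast
        from VL'(2) VL(2) have "?closed V' \<or> Suc i < length V'" by linarith
        with VL'(1) show ?case unfolding holds_nset by blast
      qed simp
    next
      case (9 \<sigma>')
      then show ?case by (intro final)
    qed (use inp in \<open>auto simp: is_input_def add_mult_distrib2\<close>)
  qed (use T in simp_all)
qed

section \<open>Memory invariants after the exploration\<close>

locale stored_exploration = full_exploration G w s V L d f
  for G :: "(nat, nat) pre_digraph" (structure) and w s V L d f +
  fixes t k :: nat
begin

text \<open>Array 14 is left out because \<open>relax\<close> lowers its entries.\<close>

definition ready :: "mem \<Rightarrow> bool" where
  "ready \<sigma> \<longleftrightarrow> is_input G w s t k \<sigma> \<and>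
     nats \<sigma> 11 0 = length V \<and> (\<forall>i<length V. nats \<sigma> 10 i = V ! i) \<and>
     nats \<sigma> 13 0 = length L \<and> (\<forall>i<length L. nats \<sigma> 12 i = L ! i)"

lemma ready_same_outside:
  "ready \<sigma> \<Longrightarrow> same_outside A B \<sigma> \<sigma>' \<Longrightarrow> A \<inter> {0, 1, 2, 10, 11, 12, 13} = {} \<Longrightarrow> 0 \<notin> B \<Longrightarrow> ready \<sigma>'"
  using is_input_same_outside[of G w s t k \<sigma> A B \<sigma>']
  by (auto simp: ready_def same_outside_def)

lemma ready_nset [simp]:
  "a \<notin> {0, 1, 2, 10, 11, 12, 13} \<Longrightarrow> ready (nset a i x \<sigma>) \<longleftrightarrow> ready \<sigma>"
  by (auto simp: ready_def is_input_def)

lemma readyD: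
  assumes "ready \<sigma>"
  shows "nats \<sigma> 0 0 = card (verts G)" "nats \<sigma> 0 (Suc 0) = card (arcs G)" "nats \<sigma> 0 2 = s"
    "nats \<sigma> 0 3 = t" "nats \<sigma> 0 4 = k" "nats \<sigma> 11 0 = length V" "nats \<sigma> 13 0 = length L"
    "\<And>i. i < length V \<Longrightarrow> nats \<sigma> 10 i = V ! i" "\<And>i. i < length L \<Longrightarrow> nats \<sigma> 12 i = L ! i"
    "\<And>i. i < length L \<Longrightarrow> nats \<sigma> (Suc 0) (L ! i) = tail G (L ! i)"
    "\<And>i. i < length L \<Longrightarrow> nats \<sigma> 2 (L ! i) = head G (L ! i)"
  using assms tight nth_mem[of _ L] by (auto simp: ready_def is_input_def)

definition counted :: "nat \<Rightarrow> mem \<Rightarrow> bool" where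
  "counted u \<sigma> \<longleftrightarrow>
     (\<forall>v\<in>tail G ` set L \<union> head G ` set L \<union> {t, u}. nats \<sigma> 15 v = capped (W u v))"

lemma countedD:
  assumes "counted u \<sigma>"
  shows "e \<in> set L \<Longrightarrow> nats \<sigma> 15 (tail G e) = capped (W u (tail G e))"
    "e \<in> set L \<Longrightarrow> nats \<sigma> 15 (head G e) = capped (W u (head G e))"
    "nats \<sigma> 15 t = capped (W u t)"
  using assms by (auto simp: counted_def)

lemma counted_nset [simp]: "a \<noteq> 15 \<Longrightarrow> counted u (nset a i x \<sigma>) \<longleftrightarrow> counted u \<sigma>"
  by (simp add: counted_def)

lemma runs_sweep_counted:
  assumes "ready \<sigma>" "nats \<sigma> 16 0 = u" "100 * length L + 100 \<le> T"
  shows "runs sweep \<sigma> T (counted u)"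
  unfolding counted_def
proof (rule runs_sweep[OF graded_arcs_axioms L(2,1)])
  show "nats \<sigma> 1 e = tail G e \<and> nats \<sigma> 2 e = head G e" if "e \<in> set L" for e
    using assms(1) that tight by (auto simp: ready_def is_input_def)
qed (use assms in \<open>auto simp: readyD\<close>)

end

section \<open>Rounds of the decision and of the selection\<close>

abbreviation "is_one e \<equiv> BAnd (NLess (NConst 0) (NGet 15 e)) (NLess (NGet 15 e) (NConst 2))"

lemma capped_between: "0 < capped X \<and> capped X < 2 \<longleftrightarrow> (\<exists>x. X = {x})"
  by (auto simp: capped_def)

definition relax :: com where
  "relax = (let a = NGet 12 (Var 7); y = NGet 2 a; g = Inc (NGet 14 (Var 16)) in
     Cond (BAnd (is_one (NGet 1 a)) (NLess g (NGet 14 y))) (NSet 14 y g) Skip)"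

text \<open>Sources are taken in order of distance and jumps lead strictly upwards, so the bound of
  the source is final when its round begins and can be compared with \<open>k\<close> in the same
  round.\<close>

definition decide_round :: com where
  "decide_round =
     Seq (NSet 16 (NConst 0) (NGet 10 (Var 6)))
    (Seq sweep
    (Seq (For 7 (Var 13) relax)
         (Cond (BAnd (is_one (NGet 0 (NConst 3))) (BNot (NLess (NGet 0 (NConst 4)) (NGet 14 (Var 16)))))
           (NSet 4 (NConst 0) (NConst 1)) Skip)))"

text \<open>The counts from the current source serve for the whole open segment; a new sweep is made
  only when a segment is closed.\<close>

definition select_round :: com where
  "select_round = (let a = NGet 3 (Var 6); y = NGet 2 a in
     Cond (is_one y) Skip
       (Seq (Seq (NSet 5 (Var 4) a) (Seq (NSet 4 (NConst 0) (Inc (Var 4))) (NSet 16 (NConst 0) y)))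
            sweep))"

lemma wr_relax [simp]: "nwr relax = {14}" "rwr relax = {}"
  by (simp_all add: relax_def Let_def)

lemma wr_decide_round [simp]: "nwr decide_round = {4, 7, 14, 15, 16}" "rwr decide_round = {}"
  by (auto simp: decide_round_def)

lemma wr_select_round [simp]: "nwr select_round = {4, 5, 7, 15, 16}" "rwr select_round = {}"
  by (auto simp: select_round_def Let_def)

context stored_exploration
begin

lemma runs_relax:
  assumes r: "ready \<sigma>" and u: "nats \<sigma> 16 0 = u" "u \<in> set V" and c: "counted u \<sigma>"
    and g: "\<And>v. v \<in> set V \<Longrightarrow> jumps (nats \<sigma> 14 v) v"
    and T: "60 * length L + 20 \<le> T"
  shows "runs (For 7 (Var 13) relax) \<sigma> T (\<lambda>\<sigma>'.
    (\<forall>v\<in>set V. jumps (nats \<sigma>' 14 v) v) \<and> (\<forall>v. nats \<sigma>' 14 v \<le> nats \<sigma> 14 v) \<and>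
    (\<forall>v. d v \<le> d u \<longrightarrow> nats \<sigma>' 14 v = nats \<sigma> 14 v) \<and>
    (\<forall>e\<in>set L. (\<exists>r. W u (tail G e) = {r}) \<longrightarrow> nats \<sigma>' 14 (head G e) \<le> Suc (nats \<sigma> 14 u)))"
proof -
  let ?I = "\<lambda>i \<sigma>'. (\<forall>v\<in>set V. jumps (nats \<sigma>' 14 v) v) \<and> (\<forall>v. nats \<sigma>' 14 v \<le> nats \<sigma> 14 v) \<and>
    (\<forall>v. d v \<le> d u \<longrightarrow> nats \<sigma>' 14 v = nats \<sigma> 14 v) \<and>
    (\<forall>j<i. (\<exists>r. W u (tail G (L ! j)) = {r}) \<longrightarrow> nats \<sigma>' 14 (head G (L ! j)) \<le> Suc (nats \<sigma> 14 u))"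
  show ?thesis
  proof (rule runs_conseq[OF runs_For[where n = "length L" and I = ?I and B = 40
        and T = "60 * length L + 20"]], goal_cases)
    case (6 i \<sigma>2)
    note [simp] = same_outsideD[OF 6(4)]
    let ?e = "L ! i"
    have e: "?e \<in> set L" using 6(1) by simp
    have fu: "nats \<sigma>2 14 u = nats \<sigma> 14 u" using 6(2) by simp
    have eff: "eff relax \<sigma>2 = (if (\<exists>r. W u (tail G ?e) = {r}) \<and>
        Suc (nats \<sigma> 14 u) < nats \<sigma>2 14 (head G ?e)
        then nset 14 (head G ?e) (Suc (nats \<sigma> 14 u)) \<sigma>2 else \<sigma>2)"
      using 6(1,3) readyD[OF r] countedD(1)[OF c e] u(1) fu
      by (simp add: relax_def Let_def capped_between)
    show ?case
    proof (cases "(\<exists>r. W u (tail G ?e) = {r}) \<and> Suc (nats \<sigma> 14 u) < nats \<sigma>2 14 (head G ?e)")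
      case True
      then obtain p where p: "W u (tail G ?e) = {p}" by blast
      have j: "jumps (Suc (nats \<sigma> 14 u)) (head G ?e)" by (rule jumps.jump[OF g[OF u(2)] p e])
      \<comment> \<open>The jump ends strictly above \<open>u\<close>, so the bounds at the level of
        \<open>u\<close> and below stay fixed, in particular the bound of \<open>u\<close> used in
        all relaxations.\<close>
      have "d u < d (head G ?e)"
        using walks_le[of p u "tail G ?e"] graded[OF e] p by force
      then have ne: "d v \<le> d u \<Longrightarrow> v \<noteq> head G ?e" for v by auto
      have le: "Suc (nats \<sigma> 14 u) \<le> nats \<sigma> 14 (head G ?e)"
        using True 6(2) by (metis less_imp_le order_trans)
      have "?I (Suc i) (nset 7 0 (Suc i) (nset 14 (head G ?e) (Suc (nats \<sigma> 14 u)) \<sigma>2))"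
        using 6(2) j ne le by (auto simp: less_Suc_eq)
      with True show ?thesis
        by (intro runs_loop_free) (simp_all only: eff if_True, simp_all add: relax_def Let_def)
    next
      case False
      then have "?I (Suc i) (nset 7 0 (Suc i) \<sigma>2)"
        using 6(2) by (auto simp: less_Suc_eq)
      with False show ?thesis
        by (intro runs_loop_free) (simp_all only: eff if_False, simp_all add: relax_def Let_def)
    qed
  next
    case (9 \<sigma>')
    then show ?case by (auto simp: in_set_conv_nth)
  qed (use T readyD[OF r] g in auto)
qed

text \<open>Intermediate state of a shortest-path computation in an acyclic graph: all bounds are
  witnessed by jumps, and the inequalities of a feasible potential hold for jumps out of the first
  \<open>i\<close> vertices.\<close>

definition settled :: "nat \<Rightarrow> (nat \<Rightarrow> nat) \<Rightarrow> bool" where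
  "settled i g \<longleftrightarrow> g s = 0 \<and> (\<forall>v\<in>set V. jumps (g v) v) \<and>
     (\<forall>u\<in>set (take i V). \<forall>e\<in>set L. (\<exists>r. W u (tail G e) = {r}) \<longrightarrow> g (head G e) \<le> Suc (g u))"

definition found :: "nat \<Rightarrow> (nat \<Rightarrow> nat) \<Rightarrow> bool" where
  "found i g \<longleftrightarrow> (\<exists>u\<in>set (take i V). g u \<le> k \<and> (\<exists>r. W u t = {r}))"

lemma settled_init: "settled 0 f"
  using start jumps_parent by (auto simp: settled_def)

text \<open>With all vertices processed, \<open>g\<close> satisfies the hypotheses of
  \<open>jumps_least\<close>, so \<open>g u\<close> is the least number of jumps to
  \<open>u\<close>.\<close>

lemma found_iff:
  assumes "settled (length V) g"
  shows "found (length V) g \<longleftrightarrow> (\<exists>S\<subseteq>arcs G. forcing_set w s t S \<and> card S \<le> k)"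
proof -
  have *: "g u \<le> k' \<and> u \<in> set V" if "jumps k' u" for k' u
  proof (rule jumps_least[OF _ _ _ _ that])
    show "head G a \<in> set V" if "a \<in> set L" for a using that tight by simp
  qed (use assms start in \<open>auto simp: settled_def\<close>)
  have "found (length V) g \<longleftrightarrow> (\<exists>k' u r. k' \<le> k \<and> jumps k' u \<and> W u t = {r})"
    using assms * unfolding found_def settled_def take_all[OF order_refl] by (meson order_trans)
  then show ?thesis by (simp add: ex_forcing_set_iff)
qed

lemma runs_decide_round:
  assumes i: "i < length V" "nats \<sigma> 6 0 = i" and r: "ready \<sigma>"
    and g: "settled i (nats \<sigma> 14)" "nats \<sigma> 4 0 = (if found i (nats \<sigma> 14) then 1 else 0)"
    and T: "160 * length L + 200 \<le> T"
  shows "runs decide_round \<sigma> T (\<lambda>\<sigma>'. ready \<sigma>' \<and> settled (Suc i) (nats \<sigma>' 14) \<and>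
    nats \<sigma>' 4 0 = (if found (Suc i) (nats \<sigma>' 14) then 1 else 0))"
proof -
  define u where "u = V ! i"
  have tk: "take (Suc i) V = take i V @ [u]" using i by (simp add: take_Suc_conv_app_nth u_def)
  have u: "u \<in> set V" using i by (simp add: u_def)
  have before: "d v \<le> d u" if "v \<in> set (take (Suc i) V)" for v
  proof -
    from that obtain j where "j \<le> i" "v = V ! j"
      using i by (auto simp: in_set_conv_nth less_Suc_eq_le)
    then show ?thesis using sorted_nth_mono[OF V(3), of j i] i by (simp add: u_def)
  qed
  show ?thesis
    unfolding decide_round_def
  proof (rule runs_Seq[OF runs_loop_free[where Q = "\<lambda>\<sigma>'. nats \<sigma>' 16 0 = u" and T = 10],
      where ?T2.0 = "160 * length L + 180"], goal_cases)
    case 2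
    show ?case using i readyD[OF r] by (simp add: u_def)
  next
    case (4 \<sigma>1)
    note [simp] = same_outsideD[OF 4(2)]
    have r1: "ready \<sigma>1" using ready_same_outside[OF r 4(2)] by simp
    show ?case
    proof (rule runs_Seq[OF runs_sweep_counted[OF r1 4(1) order_refl],
        where ?T2.0 = "60 * length L + 70"], goal_cases)
      case (1 \<sigma>2)
      note [simp] = same_outsideD[OF 1(2)]
      have r2: "ready \<sigma>2" using ready_same_outside[OF r1 1(2)] by simp
      have u2: "nats \<sigma>2 16 0 = u" using 4(1) by simp
      have j2: "jumps (nats \<sigma>2 14 v) v" if "v \<in> set V" for v
        using g(1) that by (simp add: settled_def)
      show ?case
      proof (rule runs_Seq[OF runs_relax[OF r2 u2 u 1(1) j2 order_refl], where ?T2.0 = 40],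
          goal_cases)
        case (2 \<sigma>3)
        note [simp] = same_outsideD[OF 2(2)]
        let ?g = "nats \<sigma>3 14" and ?h = "nats \<sigma> 14"
        have r3: "ready \<sigma>3" using ready_same_outside[OF r2 2(2)] by simp
        \<comment> \<open>Vertices processed so far are at most as far as \<open>u\<close> and keep
          their bounds. Earlier inequalities persist, as only their left-hand sides can
          decrease.\<close>
        have eq: "?g v = ?h v" if "v \<in> set (take (Suc i) V)" for v
          using 2(1) before[OF that] by simp
        have le: "?g v \<le> ?h v" for v using 2(1) by simp
        have "?g s = 0" using le[of s] g(1) by (simp add: settled_def)
        moreover have "?g (head G e) \<le> Suc (?g v)"
          if "v \<in> set (take (Suc i) V)" "e \<in> set L" "\<exists>r. W v (tail G e) = {r}" for v e
        proof (cases "v = u")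
          case True
          then show ?thesis using 2(1) that eq[of v] by simp
        next
          case False
          then have "?h (head G e) \<le> Suc (?h v)"
            using g(1) that unfolding settled_def tk by simp
          then show ?thesis using le[of "head G e"] eq[OF that(1)] by simp
        qed
        ultimately have s3: "settled (Suc i) ?g" using 2(1) by (simp add: settled_def)
        have "found i ?g = found i ?h" using eq by (auto simp: found_def tk)
        then have f3: "found (Suc i) ?g \<longleftrightarrow> found i ?h \<or> ?g u \<le> k \<and> (\<exists>r. W u t = {r})"
          by (auto simp: found_def tk)
        show ?case
          using r3 s3 f3 g(2) readyD[OF r3] countedD(3)[OF 1(1)] u2
          by (intro runs_loop_free) (auto simp: capped_between)
      qed auto
    qed simp
  qed (use T in simp_all)
qed

lemma runs_decide_loop:
  assumes r: "ready \<sigma>" and f: "nats \<sigma> 14 = f" and out: "nats \<sigma> 4 0 = 0"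
    and T: "length V * (160 * length L + 220) + 20 \<le> T"
  shows "runs (For 6 (Var 11) decide_round) \<sigma> T (\<lambda>\<sigma>'. nats \<sigma>' 4 0 =
    (if \<exists>S\<subseteq>arcs G. forcing_set w s t S \<and> card S \<le> k then 1 else 0))"
proof (rule runs_conseq[OF runs_For[where n = "length V" and B = "160 * length L + 208" and
    I = "\<lambda>i \<sigma>. ready \<sigma> \<and> settled i (nats \<sigma> 14) \<and>
      nats \<sigma> 4 0 = (if found i (nats \<sigma> 14) then 1 else 0)"
      and T = "length V * (160 * length L + 220) + 20"]], goal_cases)
  case 5
  then show ?case using r settled_init out by (simp add: f found_def)
next
  case (6 i \<sigma>')
  have "runs decide_round \<sigma>' (160 * length L + 200) (\<lambda>\<sigma>'. ready \<sigma>' \<and>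
      settled (Suc i) (nats \<sigma>' 14) \<and>
      nats \<sigma>' 4 0 = (if found (Suc i) (nats \<sigma>' 14) then 1 else 0))"
    using 6 by (intro runs_decide_round) auto
  then show ?case by (rule runs_conseq) auto
next
  case (9 \<sigma>')
  then show ?case using found_iff by simp
qed (use readyD[OF r] T in \<open>auto simp: add_mult_distrib2\<close>)

text \<open>The invariant is \<open>greedy\<close> for the current output list. Here
  \<open>k\<close> is the fifth input number, which \<open>path_input\<close> sets to the length of
  the path.\<close>

lemma runs_select_loop:
  assumes p: "p \<in> W s t" "length p = k" and r: "ready \<sigma>"
    and mem: "\<And>i. i < length p \<Longrightarrow> nats \<sigma> 3 i = p ! i" "nats \<sigma> 16 0 = s" "counted s \<sigma>" "nats \<sigma> 4 0 = 0"
    and T: "k * (100 * length L + 200) + 20 \<le> T"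
  shows "runs (For 6 (NGet 0 (NConst 4)) select_round) \<sigma> T (\<lambda>\<sigma>'. distinct (list_output \<sigma>') \<and>
    min_forcing_set_for w s t p (set (list_output \<sigma>')))"
proof -
  let ?I = "\<lambda>i \<sigma>'. ready \<sigma>' \<and> (\<exists>u j. counted u \<sigma>' \<and> greedy t p i u j (list_output \<sigma>'))"
  have out_nset: "list_output (nset 6 x y \<tau>) = list_output \<tau>" for x y \<tau>
    by (simp add: list_output_def)
  show ?thesis
  proof (rule runs_conseq[OF runs_For[where n = k and I = ?I and B = "100 * length L + 188"
        and T = "k * (100 * length L + 200) + 20"]], goal_cases)
    case 5
    then show ?case using r greedy_init mem by (auto simp: out_nset) (auto simp: list_output_def)
  next
    case (6 i \<sigma>')
    note [simp] = same_outsideD[OF 6(4)]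
    have i: "i < length p" using 6(1) p(2) by simp
    let ?a = "p ! i"
    have a: "?a \<in> set L" by (rule walk_nth(1)[OF p(1) i])
    from 6(2) obtain u j where uj: "counted u \<sigma>'" "greedy t p i u j (list_output \<sigma>')"
      and r': "ready \<sigma>'" by blast
    have a': "nats \<sigma>' 3 i = ?a" "nats \<sigma>' 2 ?a = head G ?a"
      using mem(1) i a readyD(11)[OF r'] by (simp, metis in_set_conv_nth)
    show ?case
      unfolding select_round_def Let_def
    proof (rule runs_Cond[where ?T1.0 = "100 * length L + 150"], goal_cases)
      case 1
      then have "capped (W u (head G ?a)) = 1"
        using 6(3) a' countedD(2)[OF uj(1) a] by simp
      from greedy_keep[OF uj(2) p(1) i this] show ?case
        using r' uj(1) by (intro runs_loop_free) (auto simp: out_nset)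
    next
      case 2
      then have "capped (W u (head G ?a)) \<noteq> 1"
        using 6(3) a' countedD(2)[OF uj(1) a] by auto
      from greedy_cut[OF uj(2) p(1) i this]
      have g: "greedy t p (Suc i) (head G ?a) (Suc i) (list_output \<sigma>' @ [?a])" .
      show ?case
      proof (rule runs_Seq[OF runs_loop_free[where T = 40 and Q = "\<lambda>\<sigma>2. ready \<sigma>2 \<and>
          nats \<sigma>2 16 0 = head G ?a \<and> list_output \<sigma>2 = list_output \<sigma>' @ [?a]"],
          where ?T2.0 = "100 * length L + 100"], goal_cases)
        case 2
        show ?case using 6(3) a' r' by (simp add: list_output_def)
      next
        case (4 \<sigma>2)
        then have h: "ready \<sigma>2" "nats \<sigma>2 16 0 = head G ?a"
          "list_output \<sigma>2 = list_output \<sigma>' @ [?a]" by auto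
        show ?case
        proof (rule runs_conseq[OF runs_sweep_counted[of \<sigma>2 "head G ?a", OF _ _ order_refl]], goal_cases)
          case (4 \<sigma>3)
          have "ready \<sigma>3" using ready_same_outside[OF h(1) 4(2)] by simp
          moreover have "list_output \<sigma>3 = list_output \<sigma>2"
            using same_outsideD(1)[OF 4(2)] by (simp add: list_output_def)
          ultimately show ?case using 4(1) g h(3) by (auto simp: out_nset)
        qed (use h in auto)
      qed simp_all
    qed simp
  next
    case (9 \<sigma>')
    then obtain u j where "greedy t p (length p) u j (list_output \<sigma>')" by (auto simp: p(2))
    note fin = greedy_final[OF this p(1)]
    have "forces t p = forcing_set_for w s t p"
      by (auto simp: fun_eq_iff forces_def forcing_set_for_iff)
    with fin show ?case
      by (simp add: min_forcing_set_for_def is_arg_min_def not_less)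
  qed (use readyD[OF r] T in \<open>auto simp: add_mult_distrib2\<close>)
qed

end

text \<open>Without arcs the bound \<open>n * m\<close> is zero, and the \<open>n\<close> rounds of
  \<open>explore\<close> would take too long. Only the empty path can then exist, and the empty set
  forces it, so the answer is whether \<open>s\<close> equals \<open>t\<close>, for every
  \<open>k\<close>.\<close>

definition decide :: com where
  "decide = (let s = NGet 0 (NConst 2); t = NGet 0 (NConst 3) in
     Cond (NLess (NConst 0) (NGet 0 (NConst 1)))
       (Seq explore (For 6 (Var 11) decide_round))
       (Cond (BAnd (BNot (NLess s t)) (BNot (NLess t s))) (NSet 4 (NConst 0) (NConst 1)) Skip))"

definition select :: com where
  "select =
     Cond (NLess (NConst 0) (NGet 0 (NConst 1)))
       (Seq explore
       (Seq (NSet 16 (NConst 0) (NGet 0 (NConst 2)))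
       (Seq sweep
            (For 6 (NGet 0 (NConst 4)) select_round))))
       Skip"

section \<open>Initial memory and total running time\<close>

lemma is_input_input_mem:
  assumes "numbered_digraph G"
  shows "is_input G w s t k (input_mem G w s t k p)"
proof -
  have "e < card (arcs G)" if "e \<in> arcs G" for e
    using assms that unfolding numbered_digraph_def by blast
  then show ?thesis
    by (auto simp: is_input_def input_mem_def Let_def nth_default_def)
qed

lemma input_mem_zero:
  "a > 3 \<Longrightarrow> nats (input_mem G w s t k p) a i = 0"
  "b > 0 \<Longrightarrow> reals (input_mem G w s t k p) b i = 0"
  by (auto simp: input_mem_def Let_def)

lemma input_mem_path: "i < length p \<Longrightarrow> nats (input_mem G w s t k p) 3 i = p ! i"
  by (simp add: input_mem_def Let_def nth_default_def)

text \<open>As \<open>n\<close> and \<open>m\<close> are positive, the linear and constant terms are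
  absorbed by \<open>n * m\<close>.\<close>

lemma time_bound:
  fixes a b c n m :: nat
  assumes "0 < n" "0 < m"
  shows "n * (a * m + b) + c \<le> (a + b + c) * max 1 (n * m)"
proof -
  have "n * b \<le> b * (n * m)" "c \<le> c * (n * m)" using assms by simp_all
  moreover have "n * (a * m + b) + c = a * (n * m) + n * b + c" by (simp add: algebra_simps)
  ultimately have "n * (a * m + b) + c \<le> (a + b + c) * (n * m)"
    unfolding add_mult_distrib by linarith
  also have "\<dots> \<le> (a + b + c) * max 1 (n * m)" by (intro mult_le_mono2) simp
  finally show ?thesis .
qed

context full_exploration
begin

lemma length_arcs: "finite (arcs G) \<Longrightarrow> length L \<le> card (arcs G)"
  using L(1) tight by (metis card_mono distinct_card subsetI)

lemma length_verts: "finite (verts G) \<Longrightarrow> length V \<le> card (verts G)"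
  using V(1,2) by (metis card_mono distinct_card)

text \<open>Tight walks from \<open>s\<close> are simple. This bounds the rounds of the selection by
  \<open>n\<close>, each of which may need a sweep of cost \<open>O(m)\<close>.\<close>

lemma length_walk:
  assumes "finite (verts G)" "p \<in> W s v"
  shows "length p \<le> card (verts G)"
proof -
  have "apath s p v" by (rule apath_walk[OF assms(2)])
  then have "set (awalk_verts s p) \<subseteq> verts G" "distinct (awalk_verts s p)"
    by (auto simp: apath_def elim: awalkE)
  then have "length (awalk_verts s p) \<le> card (verts G)"
    using assms(1) by (metis card_mono distinct_card)
  then show ?thesis by (simp add: length_awalk_verts)
qed

end

lemma (in wf_digraph) no_arcs:
  assumes "arcs G = {}" "s \<in> verts G"
  shows "shortest_path w s t p \<longleftrightarrow> s = t \<and> p = []"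
proof -
  have "apath s q t \<longleftrightarrow> s = t \<and> q = []" for q
    using assms by (cases q) (simp_all add: apath_def awalk_def)
  then show ?thesis unfolding shortest_path_def is_arg_min_def by fastforce
qed

lemma runs_decide:
  assumes G: "numbered_digraph G" "s \<in> verts G" "t \<in> verts G" "\<And>e. e \<in> arcs G \<Longrightarrow> 0 < w e"
  shows "runs decide (decision_input G w s t k) (1000 * max 1 (card (verts G) * card (arcs G)))
    (\<lambda>\<sigma>. bool_output \<sigma> =
      (if \<exists>S\<subseteq>arcs G. wf_digraph.forcing_set G w s t S \<and> card S \<le> k then 1 else 0))"
proof -
  interpret fin_digraph G using G(1) by (simp add: numbered_digraph_def)
  let ?n = "card (verts G)" and ?m = "card (arcs G)" and ?\<sigma> = "input_mem G w s t k []"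
  have inp: "is_input G w s t k ?\<sigma>" by (rule is_input_input_mem[OF G(1)])
  then have i: "nats ?\<sigma> 0 (Suc 0) = ?m" "nats ?\<sigma> 0 2 = s" "nats ?\<sigma> 0 3 = t"
    by (auto simp: is_input_def)
  show ?thesis
  proof (cases "?m = 0")
    case True
    then have "arcs G = {}" by simp
    then have "(\<exists>S\<subseteq>arcs G. forcing_set w s t S \<and> card S \<le> k) \<longleftrightarrow> s = t"
      using G(2) by (auto simp: forcing_set_def forcing_set_for_def no_arcs)
    moreover have "nats ?\<sigma> 4 0 = 0" by (simp add: input_mem_zero)
    moreover have "runs decide ?\<sigma> 1000 (\<lambda>\<sigma>. nats \<sigma> 4 0 = (if s = t then 1 else 0))"
      unfolding decide_def Let_def
    proof (rule runs_Cond[where ?T1.0 = 50], goal_cases)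
      case 1
      then show ?case using i True by simp
    next
      case 2
      show ?case using i by (intro runs_loop_free) (auto simp: input_mem_zero)
    qed simp
    ultimately show ?thesis
      unfolding decision_input_def bool_output_def by (simp add: True)
  next
    case False
    have n: "0 < ?n" using G(2) by (auto simp: card_gt_0_iff)
    have "runs decide ?\<sigma> (?n * (360 * ?m + 440) + 100) (\<lambda>\<sigma>. nats \<sigma> 4 0 =
      (if \<exists>S\<subseteq>arcs G. forcing_set w s t S \<and> card S \<le> k then 1 else 0))"
      unfolding decide_def Let_def
    proof (rule runs_Cond[where ?T1.0 = "?n * (360 * ?m + 440) + 90"], goal_cases)
      case 1
      show ?case
      proof (rule runs_Seq[OF runs_explore[OF G(1,2,4) inp _ _ _ _ order_refl],
            where ?T2.0 = "?n * (160 * ?m + 220) + 20"], goal_cases)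
        case (6 \<sigma>)
        then obtain V L where VL: "holds_exploration G w s V L \<sigma>"
          "full_exploration G w s V L (reals \<sigma> 2) (nats \<sigma> 14)" by blast
        interpret stored_exploration G w s V L "reals \<sigma> 2" "nats \<sigma> 14" t k
          using VL(2) by (simp add: stored_exploration_def)
        have "ready \<sigma>"
          using VL(1) is_input_same_outside[OF inp 6(2)] by (simp add: ready_def holds_exploration_def)
        moreover have "nats \<sigma> 4 0 = 0"
          using same_outsideD(1)[OF 6(2), of 4] by (simp add: input_mem_zero)
        moreover have "length V * (160 * length L + 220) + 20 \<le> ?n * (160 * ?m + 220) + 20"
          using length_arcs length_verts by (intro add_mono mult_mono) auto
        ultimately show ?case by (intro runs_decide_loop) auto
      qed (auto simp: input_mem_zero G(4) algebra_simps)
    next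
      case 2
      then show ?case using i False by simp
    qed simp
    then show ?thesis
      unfolding decision_input_def bool_output_def
      by (rule runs_conseq) (use time_bound[OF n, of ?m 360 440 100] False in auto)
  qed
qed

lemma runs_select:
  assumes G: "numbered_digraph G" "s \<in> verts G" "t \<in> verts G" "\<And>e. e \<in> arcs G \<Longrightarrow> 0 < w e"
    and p: "wf_digraph.shortest_path G w s t p"
  shows "runs select (path_input G w s t p) (2000 * max 1 (card (verts G) * card (arcs G)))
    (\<lambda>\<sigma>. distinct (list_output \<sigma>) \<and>
      wf_digraph.min_forcing_set_for G w s t p (set (list_output \<sigma>)))"
proof -
  interpret fin_digraph G using G(1) by (simp add: numbered_digraph_def)
  let ?n = "card (verts G)" and ?m = "card (arcs G)" and ?l = "length p"
    and ?\<sigma> = "input_mem G w s t (length p) p"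
  have inp: "is_input G w s t ?l ?\<sigma>" by (rule is_input_input_mem[OF G(1)])
  then have i: "nats ?\<sigma> 0 (Suc 0) = ?m" "nats ?\<sigma> 0 2 = s"
    by (auto simp: is_input_def)
  show ?thesis
  proof (cases "?m = 0")
    case True
    then have "arcs G = {}" by simp
    then have "min_forcing_set_for w s t p {}"
      using p G(2) by (auto simp: min_forcing_set_for_def is_arg_min_def forcing_set_for_def no_arcs)
    moreover have "list_output ?\<sigma> = []" by (simp add: list_output_def input_mem_zero)
    moreover have "runs select ?\<sigma> 2000 (\<lambda>\<sigma>. \<sigma> = ?\<sigma>)"
      unfolding select_def
    proof (rule runs_Cond[where ?T1.0 = 50], goal_cases)
      case 1
      then show ?case using i True by simp
    next
      case 2
      show ?case by (intro runs_loop_free) auto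
    qed simp
    ultimately show ?thesis
      unfolding path_input_def by (elim runs_conseq) auto
  next
    case False
    have n: "0 < ?n" using G(2) by (auto simp: card_gt_0_iff)
    have "runs select ?\<sigma> (?n * (400 * ?m + 420) + 260) (\<lambda>\<sigma>. distinct (list_output \<sigma>) \<and>
        min_forcing_set_for w s t p (set (list_output \<sigma>)))"
      unfolding select_def
    proof (rule runs_Cond[where ?T1.0 = "?n * (400 * ?m + 420) + 240"], goal_cases)
      case 1
      show ?case
      proof (rule runs_Seq[OF runs_explore[OF G(1,2,4) inp _ _ _ _ order_refl],
            where ?T2.0 = "?n * (200 * ?m + 200) + 170"], goal_cases)
        case (6 \<sigma>)
        then obtain V L where VL: "holds_exploration G w s V L \<sigma>"
          "full_exploration G w s V L (reals \<sigma> 2) (nats \<sigma> 14)" by blast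
        note [simp] = same_outsideD[OF 6(2)]
        interpret stored_exploration G w s V L "reals \<sigma> 2" "nats \<sigma> 14" t ?l
          using VL(2) by (simp add: stored_exploration_def)
        have r: "ready \<sigma>"
          using VL(1) is_input_same_outside[OF inp 6(2)] by (simp add: ready_def holds_exploration_def)
        have w: "p \<in> W s t" using p by (simp add: shortest_path_iff)
        have lL: "length L \<le> ?m" and lp: "?l \<le> ?n"
          using length_arcs length_walk[OF _ w] by auto
        show ?case
        proof (rule runs_Seq[OF runs_loop_free[where T = 10 and Q = "\<lambda>\<sigma>'. ready \<sigma>' \<and>
            nats \<sigma>' 16 0 = s \<and> nats \<sigma>' 4 0 = 0 \<and> nats \<sigma>' 3 = nats ?\<sigma> 3"],
            where ?T2.0 = "?n * (200 * ?m + 200) + 150"], goal_cases)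
          case 2
          then show ?case using r i by (simp add: input_mem_zero)
        next
          case (4 \<sigma>1)
          then have \<sigma>1: "ready \<sigma>1" "nats \<sigma>1 16 0 = s" "nats \<sigma>1 4 0 = 0" "nats \<sigma>1 3 = nats ?\<sigma> 3"
            by auto
          show ?case
          proof (rule runs_Seq[OF runs_sweep_counted[OF \<sigma>1(1,2) order_refl],
              where ?T2.0 = "?l * (100 * length L + 200) + 20"], goal_cases)
            case (1 \<sigma>2)
            note [simp] = same_outsideD[OF 1(2)]
            show ?case
            proof (rule runs_select_loop[OF w refl _ _ _ 1(1)])
              show "ready \<sigma>2" using ready_same_outside[OF \<sigma>1(1) 1(2)] by simp
            qed (use \<sigma>1 in \<open>simp_all add: input_mem_path\<close>)
          next
            case 2
            have "?l * (100 * length L + 200) \<le> ?n * (100 * ?m + 200)"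
              using lL lp by (intro mult_mono) auto
            \<comment> \<open>The initial sweep from \<open>s\<close> happens once; since
              \<open>n\<close> is positive, it can be charged to \<open>n * m\<close>.\<close>
            moreover have "100 * length L \<le> ?n * (100 * ?m)"
              using lL n by (metis mult.commute mult_le_mono mult_le_mono2 nat_mult_1_right Suc_leI One_nat_def)
            ultimately show ?case by (simp add: algebra_simps)
          qed
        qed auto
      qed (auto simp: input_mem_zero G(4) algebra_simps)
    next
      case 2
      then show ?case using i False by simp
    qed simp
    then show ?thesis
      unfolding path_input_def
      by (rule runs_conseq) (use time_bound[OF n, of ?m 400 420 260] False in auto)
  qed
qed

text \<open>Program and constant are chosen before the instance. The maximum with 1 covers graphs
  without arcs, where a run still takes at least one time unit.\<close>

theorem theorem1:
  shows "(\<exists>(prog :: com) (C :: nat). \<forall>(G :: (nat, nat) pre_digraph) (w :: nat \<Rightarrow> real) s t (k :: nat).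
      numbered_digraph G \<and> s \<in> verts G \<and> t \<in> verts G \<and> (\<forall>e\<in>arcs G. 0 < w e) \<longrightarrow>
      (\<exists>\<tau> \<sigma>. exec prog (decision_input G w s t k) \<tau> \<sigma> \<and>
         \<tau> \<le> C * max 1 (card (verts G) * card (arcs G)) \<and>
         bool_output \<sigma> =
           (if \<exists>S \<subseteq> arcs G. wf_digraph.forcing_set G w s t S \<and> card S \<le> k then 1 else 0)))
    \<and>
    (\<exists>(prog :: com) (C :: nat). \<forall>(G :: (nat, nat) pre_digraph) (w :: nat \<Rightarrow> real) s t (p :: nat list).
      numbered_digraph G \<and> s \<in> verts G \<and> t \<in> verts G \<and> (\<forall>e\<in>arcs G. 0 < w e) \<and>
      wf_digraph.shortest_path G w s t p \<longrightarrow>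
      (\<exists>\<tau> \<sigma>. exec prog (path_input G w s t p) \<tau> \<sigma> \<and>
         \<tau> \<le> C * max 1 (card (verts G) * card (arcs G)) \<and>
         distinct (list_output \<sigma>) \<and>
         wf_digraph.min_forcing_set_for G w s t p (set (list_output \<sigma>))))"
    (is "?A \<and> ?B")
proof (rule conjI)
  show ?A
    by (rule exI[of _ decide], rule exI[of _ 1000])
      (use runs_decide in \<open>simp add: runs_def\<close>)
  show ?B
    by (rule exI[of _ select], rule exI[of _ 2000])
      (use runs_select in \<open>simp add: runs_def\<close>)
qed

end
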